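(* Let $n\ge1$. The homoscedastic secant $\operatorname{Sec}^H_2(\mathcal G_{n,4})$ is algebraically identifiable, i.e. $\Delta^H_{n,2,4}=0$. Moreover, for every $d\ge5$, $\operatorname{Sec}^H_2(\mathcal G_{n,d})$ is rationally identifiable: the fiber of $M_{n,2,d}$ over a general point of its image consists of a single parameter up to label swapping.
   Context: Fix integers $n,k,d\ge1$, $u=(u_1,\dots,u_n)$. Parameter space $\Theta^H_{n,k}=\{((\mu_1,\dots,\mu_k),(\lambda_1,\dots,\lambda_k),\Sigma): \mu_i\in\mathbb{R}^n,\ \lambda_i\in\mathbb{R},\ \sum_i\lambda_i=1,\ \Sigma\in\mathbb{R}^{n\times n}\text{ symmetric}\}$. The moment map $M_{n,k,d}$ sends a parameter to the coefficient vector $(m_a)_{1\le|a|\le d}$ of the truncation modulo $(u)^{d+1}$ of $\sum_{i}\lambda_i\exp(u^t\mu_i+\tfrac12u^t\Sigma u)=\sum_a m_a u^a/a!$ (the moments of order $\le d$ of $\sum_i\lambda_i\mathcal N(\mu_i,\Sigma)$). $\operatorname{Sec}^H_k(\mathcal G_{n,d})$ is the Zariski closure of its image and $\Delta^H_{n,k,d}=\dim\Theta^H_{n,k}-\dim\operatorname{Sec}^H_k(\mathcal G_{n,d})$ is the general fiber dimension; algebraic identifiability means $\Delta^H_{n,k,d}=0$. Label swapping for $k=2$ means exchanging $(\mu_1,\lambda_1)$ with $(\mu_2,\lambda_2)$. *)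

theory Defs
  imports "HOL-Analysis.Analysis" "HOL-Library.Numeral_Type"
begin

inductive_set poly_fun :: "(('i \<Rightarrow> real) \<Rightarrow> real) set" where
  const: "(\<lambda>x. c) \<in> poly_fun"
| var: "(\<lambda>x. x i) \<in> poly_fun"
| add: "p \<in> poly_fun \<Longrightarrow> q \<in> poly_fun \<Longrightarrow> (\<lambda>x. p x + q x) \<in> poly_fun"
| mult: "p \<in> poly_fun \<Longrightarrow> q \<in> poly_fun \<Longrightarrow> (\<lambda>x. p x * q x) \<in> poly_fun"

definition zariski_closed :: "('i \<Rightarrow> real) set \<Rightarrow> bool" where
  "zariski_closed S \<longleftrightarrow> (\<exists>P \<subseteq> poly_fun. S = {x. \<forall>p\<in>P. p x = 0})"

definition zariski_closure :: "('i \<Rightarrow> real) set \<Rightarrow> ('i \<Rightarrow> real) set" where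
  "zariski_closure S = \<Inter>{T. zariski_closed T \<and> S \<subseteq> T}"

definition zariski_irreducible :: "('i \<Rightarrow> real) set \<Rightarrow> bool" where
  "zariski_irreducible X \<longleftrightarrow> zariski_closed X \<and> X \<noteq> {} \<and>
     (\<forall>A B. zariski_closed A \<longrightarrow> zariski_closed B \<longrightarrow> X = A \<union> B \<longrightarrow> X = A \<or> X = B)"

definition zariski_dim :: "('i \<Rightarrow> real) set \<Rightarrow> nat" where
  "zariski_dim X = Sup {m. \<exists>Z. (\<forall>i\<le>m. zariski_irreducible (Z i) \<and> Z i \<subseteq> X) \<and>
                              (\<forall>i<m. Z i \<subset> Z (Suc i))}"

type_synonym ('n, 'k) hparam = "('k \<times> 'n + 'k + 'n \<times> 'n) \<Rightarrow> real"

definition hmu :: "('n, 'k) hparam \<Rightarrow> 'k \<Rightarrow> 'n \<Rightarrow> real" where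
  "hmu \<theta> i j = \<theta> (Inl (i, j))"
definition hlam :: "('n, 'k) hparam \<Rightarrow> 'k \<Rightarrow> real" where
  "hlam \<theta> i = \<theta> (Inr (Inl i))"
definition hSigma :: "('n, 'k) hparam \<Rightarrow> 'n \<Rightarrow> 'n \<Rightarrow> real" where
  "hSigma \<theta> j l = \<theta> (Inr (Inr (j, l)))"

definition Theta_H :: "('n::finite, 'k::finite) hparam set" where
  "Theta_H = {\<theta>. (\<Sum>i\<in>UNIV. hlam \<theta> i) = 1 \<and> (\<forall>j l. hSigma \<theta> j l = hSigma \<theta> l j)}"

definition mgf :: "('n::finite, 'k::finite) hparam \<Rightarrow> ('n \<Rightarrow> real) \<Rightarrow> real" where
  "mgf \<theta> u = (\<Sum>i\<in>UNIV. hlam \<theta> i *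
      exp ((\<Sum>j\<in>UNIV. u j * hmu \<theta> i j) + 1/2 * (\<Sum>j\<in>UNIV. \<Sum>l\<in>UNIV. u j * hSigma \<theta> j l * u l)))"

definition pdiff :: "'n \<Rightarrow> (('n \<Rightarrow> real) \<Rightarrow> real) \<Rightarrow> ('n \<Rightarrow> real) \<Rightarrow> real" where
  "pdiff j g u = deriv (\<lambda>t. g (u(j := u j + t))) 0"

fun pdiffs :: "'n list \<Rightarrow> (('n \<Rightarrow> real) \<Rightarrow> real) \<Rightarrow> ('n \<Rightarrow> real) \<Rightarrow> real" where
  "pdiffs [] g = g"
| "pdiffs (j # js) g = pdiff j (pdiffs js g)"

text \<open>m_a = partial^a F(0), i.e. the coefficient of u^a/a! in the Taylor expansion.\<close>
definition moment :: "('n::finite \<Rightarrow> nat) \<Rightarrow> ('n, 'k::finite) hparam \<Rightarrow> real" where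
  "moment a \<theta> = pdiffs (SOME js. \<forall>j. count_list js j = a j) (mgf \<theta>) (\<lambda>_. 0)"

definition moment_map :: "nat \<Rightarrow> ('n::finite, 'k::finite) hparam \<Rightarrow> (('n \<Rightarrow> nat) \<Rightarrow> real)" where
  "moment_map d \<theta> = (\<lambda>a. if 1 \<le> sum a UNIV \<and> sum a UNIV \<le> d then moment a \<theta> else 0)"

definition Sec_H :: "'n::finite itself \<Rightarrow> 'k::finite itself \<Rightarrow> nat \<Rightarrow> (('n \<Rightarrow> nat) \<Rightarrow> real) set" where
  "Sec_H _ _ d = zariski_closure (moment_map d ` (Theta_H :: ('n, 'k) hparam set))"

definition Delta_H :: "'n::finite itself \<Rightarrow> 'k::finite itself \<Rightarrow> nat \<Rightarrow> int" where
  "Delta_H nn kk d = int (zariski_dim (Theta_H :: ('n, 'k) hparam set)) - int (zariski_dim (Sec_H nn kk d))"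

text \<open>Label swapping for k = 2 (type 2 has elements 0, 1; i + 1 swaps them).\<close>
definition swap_labels :: "('n, 2) hparam \<Rightarrow> ('n, 2) hparam" where
  "swap_labels \<theta> = (\<lambda>c. case c of
       Inl (i, j) \<Rightarrow> \<theta> (Inl (i + 1, j))
     | Inr (Inl i) \<Rightarrow> \<theta> (Inr (Inl (i + 1)))
     | Inr (Inr p) \<Rightarrow> \<theta> (Inr (Inr p)))"

end

theory Submission
  imports Defs
begin

text \<open>
  The parameter space is polynomially isomorphic to an affine space: with \<open>p = \<lambda>\<^sub>1\<close>, the mean
  \<open>m\<close> of the mixture, the difference \<open>\<delta> = \<mu>\<^sub>2 - \<mu>\<^sub>1\<close> and the covariance
  \<open>K = \<Sigma> + p (1 - p) \<delta> \<delta>\<^sup>T\<close> of the mixture are free coordinates. In these coordinates the cumulants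
  of order 3, 4, 5 in a fixed direction are \<open>P S\<close>, \<open>P S\<^sup>2 - 2 P\<^sup>2\<close>, \<open>P S\<^sup>3 - 8 P\<^sup>2 S\<close> where
  \<open>P = p (1 - p) \<delta>\<^sup>2\<close> and \<open>S = (2 p - 1) \<delta>\<close>. Equality of two such triples forces
  \<open>P = P'\<close> and \<open>S = S'\<close> as soon as \<open>P S \<noteq> 0\<close>, which fixes \<open>\<delta>\<close> up to sign, hence everything
  up to label swapping.

  For the dimension, coordinates are switched on one at a time, and some moment of order at most 4 vanishes
  before a coordinate is switched on but not after. The closures of the images of the coordinate
  subspaces therefore form a strict chain of irreducible sets, as long as the number of coordinates. No
  chain is longer: a strict chain of irreducible sets produces as many algebraically independent
  functions, and counting monomials shows that there are no more of these than coordinates.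
\<close>

section \<open>Polynomial functions and the Zariski topology\<close>

lemma poly_fun_uminus: "p \<in> poly_fun \<Longrightarrow> (\<lambda>x. - p x) \<in> poly_fun"
  using poly_fun.mult[OF poly_fun.const[of "-1"], of p] by simp

lemma poly_fun_diff: "p \<in> poly_fun \<Longrightarrow> q \<in> poly_fun \<Longrightarrow> (\<lambda>x. p x - q x) \<in> poly_fun"
  using poly_fun.add[OF _ poly_fun_uminus, of p q] by simp

lemma poly_fun_power: "p \<in> poly_fun \<Longrightarrow> (\<lambda>x. p x ^ k) \<in> poly_fun"
  by (induction k) (auto intro: poly_fun.intros)

lemma poly_fun_sum: "(\<And>a. a \<in> A \<Longrightarrow> f a \<in> poly_fun) \<Longrightarrow> (\<lambda>x. \<Sum>a\<in>A. f a x) \<in> poly_fun"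
  by (induction A rule: infinite_finite_induct) (auto intro: poly_fun.intros)

lemma poly_fun_prod: "(\<And>a. a \<in> A \<Longrightarrow> f a \<in> poly_fun) \<Longrightarrow> (\<lambda>x. \<Prod>a\<in>A. f a x) \<in> poly_fun"
  by (induction A rule: infinite_finite_induct) (auto intro: poly_fun.intros)

lemma poly_fun_compose:
  assumes "p \<in> poly_fun" "\<And>c. (\<lambda>x. F x c) \<in> poly_fun"
  shows "(\<lambda>x. p (F x)) \<in> poly_fun"
  using assms(1) by induction (auto intro: assms(2) poly_fun.intros)

section \<open>Restriction of polynomial functions to lines, coordinates and grids\<close>

lemma poly_fun_on_line:
  assumes "p \<in> poly_fun"
  shows "\<exists>P. \<forall>t. p (\<lambda>i. x i + t * (y i - x i)) = poly P t"
  using assms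
proof induction
  case (const c)
  show ?case by (rule exI[of _ "[:c:]"]) simp
next
  case (var i)
  show ?case by (rule exI[of _ "[:x i, y i - x i:]"]) simp
next
  case (add p q)
  then show ?case by (metis poly_add)
next
  case (mult p q)
  then show ?case by (metis poly_mult)
qed

text \<open>On the line from x to y both functions are univariate polynomials. The one of p is
  nonzero at t = 0, so the one of q is the zero polynomial, and t = 1 gives the value at y.\<close>

lemma poly_fun_no_zero_divisors:
  assumes "p \<in> poly_fun" "q \<in> poly_fun" "\<And>x. p x * q x = 0" "p x \<noteq> 0"
  shows "q y = 0"
proof -
  obtain P where P: "\<And>t. p (\<lambda>i. x i + t * (y i - x i)) = poly P t"
    using poly_fun_on_line[OF assms(1)] by metis
  obtain Q where Q: "\<And>t. q (\<lambda>i. x i + t * (y i - x i)) = poly Q t"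
    using poly_fun_on_line[OF assms(2)] by metis
  have "poly (P * Q) t = 0" for t
    using assms(3) P[of t] Q[of t] by (metis poly_mult)
  then have "P * Q = 0" by (meson poly_all_0_iff_0)
  moreover have "P \<noteq> 0" using P[of 0] assms(4) by auto
  ultimately have "Q = 0" by simp
  then show ?thesis using Q[of 1] by simp
qed

text \<open>The bound is uniform in the coordinate and in the base point, so that a grid size can be
  fixed in advance.\<close>

lemma poly_fun_degree_bound:
  assumes "p \<in> poly_fun"
  shows "\<exists>D. \<forall>c x. \<exists>q. degree q \<le> D \<and> (\<forall>t. p (x(c := t)) = poly q t)"
  using assms
proof induction
  case (const c)
  show ?case by (rule exI[of _ 0], intro allI, rule exI[of _ "[:c:]"]) simp
next
  case (var i)
  show ?case
  proof (rule exI[of _ 1], intro allI)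
    fix c and x :: "'a \<Rightarrow> real"
    show "\<exists>q. degree q \<le> 1 \<and> (\<forall>t. (x(c := t)) i = poly q t)"
      by (cases "i = c") (auto intro: exI[of _ "[:0, 1:]"] exI[of _ "[:x i:]"])
  qed
next
  case (add p q)
  then obtain D E where D: "\<And>c x. \<exists>r. degree r \<le> D \<and> (\<forall>t. p (x(c := t)) = poly r t)"
    and E: "\<And>c x. \<exists>r. degree r \<le> E \<and> (\<forall>t. q (x(c := t)) = poly r t)" by blast
  show ?case
  proof (rule exI[of _ "max D E"], intro allI)
    fix c x
    obtain r s where "degree r \<le> D" "\<And>t. p (x(c := t)) = poly r t"
      "degree s \<le> E" "\<And>t. q (x(c := t)) = poly s t" using D E by metis
    then show "\<exists>r. degree r \<le> max D E \<and> (\<forall>t. p (x(c := t)) + q (x(c := t)) = poly r t)"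
      by (intro exI[of _ "r + s"]) (auto intro: degree_add_le)
  qed
next
  case (mult p q)
  then obtain D E where D: "\<And>c x. \<exists>r. degree r \<le> D \<and> (\<forall>t. p (x(c := t)) = poly r t)"
    and E: "\<And>c x. \<exists>r. degree r \<le> E \<and> (\<forall>t. q (x(c := t)) = poly r t)" by blast
  show ?case
  proof (rule exI[of _ "D + E"], intro allI)
    fix c x
    obtain r s where "degree r \<le> D" "\<And>t. p (x(c := t)) = poly r t"
      "degree s \<le> E" "\<And>t. q (x(c := t)) = poly s t" using D E by metis
    then show "\<exists>r. degree r \<le> D + E \<and> (\<forall>t. p (x(c := t)) * q (x(c := t)) = poly r t)"
      by (intro exI[of _ "r * s"]) (auto intro: order_trans[OF degree_mult_le])
  qed
qed

text \<open>Induction on J: h vanishes whenever the new coordinate is one of 0, ..., L, and these L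
  + 1 roots are too many for a nonzero polynomial of degree at most L.\<close>

lemma zero_if_zero_on_grid:
  fixes h :: "('i \<Rightarrow> real) \<Rightarrow> real"
  assumes "finite J"
    and deg: "\<And>c x. c \<in> J \<Longrightarrow> \<exists>q. degree q \<le> L \<and> (\<forall>t. h (x(c := t)) = poly q t)"
    and "\<And>x. (\<And>c. c \<in> J \<Longrightarrow> x c \<in> real ` {..L}) \<Longrightarrow> (\<And>c. c \<notin> J \<Longrightarrow> x c = y c) \<Longrightarrow> h x = 0"
  shows "h y = 0"
  using assms
proof (induction J arbitrary: y rule: finite_induct)
  case empty
  then show ?case by simp
next
  case (insert c J)
  obtain q where q: "degree q \<le> L" "\<And>t. h (y(c := t)) = poly q t"
    using insert.prems(1)[of c y] by blast
  have "poly q t = 0" if t: "t \<in> real ` {..L}" for t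
  proof -
    have "h (y(c := t)) = 0"
    proof (rule insert.IH)
      show "\<exists>q. degree q \<le> L \<and> (\<forall>t. h (x(c := t)) = poly q t)" if "c \<in> J" for c x
        using insert.prems(1) that by blast
      show "h x = 0" if "\<And>c. c \<in> J \<Longrightarrow> x c \<in> real ` {..L}"
        "\<And>d. d \<notin> J \<Longrightarrow> x d = (y(c := t)) d" for x
        by (rule insert.prems(2)) (use that t insert.hyps in \<open>auto split: if_splits\<close>)
    qed
    then show ?thesis using q(2) by simp
  qed
  then have "real ` {..L} \<subseteq> {t. poly q t = 0}" by auto
  moreover have "card (real ` {..L}) = Suc L" by (simp add: card_image inj_on_def)
  ultimately have "q = 0"
    using q(1) card_mono[OF poly_roots_finite, of q "real ` {..L}"] card_poly_roots_bound[of q]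
    by fastforce
  then show ?case using q(2)[of "y c"] by simp
qed

text \<open>Gaussian elimination in the unknowns \<open>c a\<close>, with one equation for each b: a
  pivot removes one equation and one unknown.\<close>

lemma underdetermined_system:
  fixes M :: "'a \<Rightarrow> 'b \<Rightarrow> real"
  assumes "finite B" "finite A" "card B < card A"
  shows "\<exists>c. (\<exists>a\<in>A. c a \<noteq> 0) \<and> (\<forall>b\<in>B. (\<Sum>a\<in>A. c a * M a b) = 0)"
  using assms
proof (induction B arbitrary: A M rule: finite_induct)
  case empty
  then have "A \<noteq> {}" by auto
  then show ?case by (intro exI[of _ "\<lambda>_. 1"]) auto
next
  case (insert b B)
  show ?case
  proof (cases "\<forall>a\<in>A. M a b = 0")
    case True
    have "card B < card A" using insert by simp
    then obtain c where "\<exists>a\<in>A. c a \<noteq> 0" "\<forall>b\<in>B. (\<Sum>a\<in>A. c a * M a b) = 0"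
      using insert.IH[OF insert.prems(1)] by blast
    then show ?thesis using True by (intro exI[of _ c]) auto
  next
    case False
    then obtain z where z: "z \<in> A" "M z b \<noteq> 0" by blast
    let ?A = "A - {z}"
    \<comment> \<open>The pivot row z clears column b; s below is then the value at z that solves
      equation b.\<close>
    let ?M = "\<lambda>a b'. M a b' - M a b / M z b * M z b'"
    have "card B < card ?A" using insert z by simp
    then obtain c where c: "\<exists>a\<in>?A. c a \<noteq> 0" "\<forall>b\<in>B. (\<Sum>a\<in>?A. c a * ?M a b) = 0"
      using insert.IH[of ?A ?M] insert.prems(1) by blast
    define s where "s = - (\<Sum>a\<in>?A. c a * M a b) / M z b"
    define c' where "c' = c(z := s)"
    have split: "(\<Sum>a\<in>A. c' a * M a b') = s * M z b' + (\<Sum>a\<in>?A. c a * M a b')" for b'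
    proof -
      have "(\<Sum>a\<in>?A. c' a * M a b') = (\<Sum>a\<in>?A. c a * M a b')"
        by (rule sum.cong) (auto simp: c'_def)
      then show ?thesis using sum.remove[OF insert.prems(1) z(1), of "\<lambda>a. c' a * M a b'"]
        by (simp add: c'_def)
    qed
    have "(\<Sum>a\<in>A. c' a * M a b') = 0" if "b' \<in> insert b B" for b'
    proof (cases "b' = b")
      case True
      then show ?thesis using split[of b] z(2) by (simp add: s_def)
    next
      case False
      have "(\<Sum>a\<in>?A. c a * ?M a b') = 0" using c(2) False that by blast
      moreover have "(\<Sum>a\<in>?A. c a * ?M a b') = (\<Sum>a\<in>?A. c a * M a b') + s * M z b'"
        by (simp add: s_def algebra_simps sum_subtractf sum_distrib_left sum_distrib_right
            sum_divide_distrib)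
      ultimately show ?thesis using split[of b'] by simp
    qed
    moreover have "\<exists>a\<in>A. c' a \<noteq> 0" using c(1) by (auto simp: c'_def)
    ultimately show ?thesis by blast
  qed
qed

section \<open>Zariski closed sets, closures and irreducibility\<close>

lemma zariski_closed_zeros: "p \<in> poly_fun \<Longrightarrow> zariski_closed {x. p x = 0}"
  unfolding zariski_closed_def by (intro exI[of _ "{p}"]) auto

text \<open>Collecting all polynomials that vanish on some member of C avoids choosing defining sets
  for the members.\<close>

lemma zariski_closed_Inter:
  assumes "\<And>S. S \<in> C \<Longrightarrow> zariski_closed S"
  shows "zariski_closed (\<Inter>C)"
proof -
  let ?P = "{p \<in> poly_fun. \<exists>S\<in>C. \<forall>x\<in>S. p x = 0}"
  have "x \<in> S" if x: "\<forall>p\<in>?P. p x = 0" and S: "S \<in> C" for x S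
  proof -
    obtain P where P: "P \<subseteq> poly_fun" "S = {x. \<forall>p\<in>P. p x = 0}"
      using assms[OF S] unfolding zariski_closed_def by blast
    have "p x = 0" if "p \<in> P" for p
    proof -
      have "\<forall>y\<in>S. p y = 0" "p \<in> poly_fun" using that P by auto
      then have "p \<in> ?P" using S by blast
      with x show ?thesis by blast
    qed
    then show ?thesis using P(2) by simp
  qed
  then have "\<Inter>C = {x. \<forall>p\<in>?P. p x = 0}" by auto
  then show ?thesis unfolding zariski_closed_def by (intro exI[of _ ?P]) auto
qed

lemma zariski_closed_Int: "zariski_closed S \<Longrightarrow> zariski_closed T \<Longrightarrow> zariski_closed (S \<inter> T)"
  using zariski_closed_Inter[of "{S, T}"] by auto

lemma zariski_closed_closure: "zariski_closed (zariski_closure S)"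
  unfolding zariski_closure_def by (rule zariski_closed_Inter) auto

lemma zariski_closure_subset: "S \<subseteq> zariski_closure S"
  unfolding zariski_closure_def by auto

lemma zariski_closure_minimal: "S \<subseteq> T \<Longrightarrow> zariski_closed T \<Longrightarrow> zariski_closure S \<subseteq> T"
  unfolding zariski_closure_def by auto

lemma zariski_closure_mono: "S \<subseteq> T \<Longrightarrow> zariski_closure S \<subseteq> zariski_closure T"
  by (meson order_trans zariski_closed_closure zariski_closure_minimal zariski_closure_subset)

lemma zero_on_zariski_closure:
  assumes "p \<in> poly_fun" "\<And>x. x \<in> S \<Longrightarrow> p x = 0" "x \<in> zariski_closure S"
  shows "p x = 0"
  using zariski_closure_minimal[OF _ zariski_closed_zeros[OF assms(1)], of S] assms by blast

lemma zariski_closed_separation: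
  assumes "zariski_closed A" "x \<notin> A"
  obtains p where "p \<in> poly_fun" "\<And>a. a \<in> A \<Longrightarrow> p a = 0" "p x \<noteq> 0"
  using assms unfolding zariski_closed_def by blast

text \<open>The vanishing ideal of an irreducible set is prime: the zero sets of p and q cover Z,
  and z rules out the first.\<close>

lemma zariski_irreducible_prime:
  assumes "zariski_irreducible Z" "p \<in> poly_fun" "q \<in> poly_fun"
    and "\<And>x. x \<in> Z \<Longrightarrow> p x * q x = 0" and "z \<in> Z" "p z \<noteq> 0" and "x \<in> Z"
  shows "q x = 0"
proof -
  let ?A = "Z \<inter> {x. p x = 0}" and ?B = "Z \<inter> {x. q x = 0}"
  have "zariski_closed ?A" "zariski_closed ?B"
    using assms(1-3) by (auto intro!: zariski_closed_Int zariski_closed_zeros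
        simp: zariski_irreducible_def)
  moreover have "Z = ?A \<union> ?B" using assms(4) by auto
  ultimately have "Z = ?A \<or> Z = ?B" using assms(1) unfolding zariski_irreducible_def by blast
  then show ?thesis using assms(5-7) by blast
qed

text \<open>Two proper closed pieces covering the closure would give two polynomials whose pullbacks
  along F are nonzero but have product zero.\<close>

lemma zariski_irreducible_closure_range:
  assumes F: "\<And>c. (\<lambda>x. F x c) \<in> poly_fun"
  shows "zariski_irreducible (zariski_closure (range F))"
  unfolding zariski_irreducible_def
proof (intro conjI allI impI)
  let ?X = "zariski_closure (range F)"
  show "zariski_closed ?X" by (rule zariski_closed_closure)
  show "?X \<noteq> {}" using zariski_closure_subset[of "range F"] by blast
  fix A B assume A: "zariski_closed A" and B: "zariski_closed B" and X: "?X = A \<union> B"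
  \<comment> \<open>The closure is the least closed set over the image, so a proper closed subset
    misses a point of the image itself, and the separating polynomial has a nonzero
    pullback.\<close>
  have *: "\<exists>p x. p \<in> poly_fun \<and> (\<forall>a\<in>C. p a = 0) \<and> p (F x) \<noteq> 0"
    if "zariski_closed C" "C \<subseteq> ?X" "?X \<noteq> C" for C
  proof -
    have "\<not> range F \<subseteq> C" using that zariski_closure_minimal[of "range F" C] by blast
    then obtain x where "F x \<notin> C" by blast
    then show ?thesis using zariski_closed_separation[OF that(1)] by metis
  qed
  show "?X = A \<or> ?X = B"
  proof (rule ccontr)
    assume neg: "\<not> (?X = A \<or> ?X = B)"
    obtain p x where p: "p \<in> poly_fun" "\<And>a. a \<in> A \<Longrightarrow> p a = 0" "p (F x) \<noteq> 0"
      using *[OF A] X neg by (metis Un_upper1 Un_upper2)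
    obtain q y where q: "q \<in> poly_fun" "\<And>a. a \<in> B \<Longrightarrow> q a = 0" "q (F y) \<noteq> 0"
      using *[OF B] X neg by (metis Un_upper1 Un_upper2)
    have "p (F z) * q (F z) = 0" for z
    proof -
      have "F z \<in> A \<union> B" using X zariski_closure_subset[of "range F"] by blast
      then show ?thesis using p(2) q(2) by auto
    qed
    moreover have "(\<lambda>x. p (F x)) \<in> poly_fun" "(\<lambda>x. q (F x)) \<in> poly_fun"
      using poly_fun_compose[of p F] poly_fun_compose[of q F] p(1) q(1) F by blast+
    ultimately have "q (F y) = 0"
      using poly_fun_no_zero_divisors[of "\<lambda>x. p (F x)" "\<lambda>x. q (F x)" x y] p(3) by blast
    with q(3) show False by simp
  qed
qed

text \<open>
  If the lowest power of \<open>f m\<close> in a relation on \<open>Z (Suc m)\<close> is cancelled, by primality, the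
  restriction to \<open>Z m\<close> is a relation between the earlier functions.
\<close>

lemma chain_monomials_independent:
  fixes f :: "nat \<Rightarrow> ('i \<Rightarrow> real) \<Rightarrow> real"
  assumes Z: "\<And>i. i \<le> M \<Longrightarrow> zariski_irreducible (Z i)" "\<And>i. i < M \<Longrightarrow> Z i \<subseteq> Z (Suc i)"
    and f: "\<And>i. i < M \<Longrightarrow> f i \<in> poly_fun" "\<And>i x. i < M \<Longrightarrow> x \<in> Z i \<Longrightarrow> f i x = 0"
      "\<And>i. i < M \<Longrightarrow> \<exists>x\<in>Z (Suc i). f i x \<noteq> 0"
    and "m \<le> M"
    and "\<forall>x\<in>Z m. (\<Sum>\<alpha>\<in>{..<m} \<rightarrow>\<^sub>E {..<K}. c \<alpha> * (\<Prod>i<m. f i x ^ \<alpha> i)) = 0"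
    and "\<alpha> \<in> {..<m} \<rightarrow>\<^sub>E {..<K}"
  shows "c \<alpha> = 0"
proof -
  have "\<forall>\<alpha>\<in>{..<m} \<rightarrow>\<^sub>E {..<K}. c \<alpha> = 0" using assms(6,7)
  proof (induction m arbitrary: c)
    case 0
    obtain x where x: "x \<in> Z 0" using Z(1)[of 0] by (auto simp: zariski_irreducible_def)
    have "{..<0::nat} \<rightarrow>\<^sub>E {..<K} = {\<lambda>_. undefined}" by (simp add: PiE_empty_domain)
    with 0 x show ?case by auto
  next
    case (Suc m)
    have m: "m < M" using Suc.prems(1) by simp
    note c = Suc.prems(2)
    let ?S = "{..<m} \<rightarrow>\<^sub>E {..<K}"
    \<comment> \<open>The coefficient of \<open>f m ^ k\<close> in the relation, a combination of
      monomials in the earlier functions.\<close>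
    define g where "g k x = (\<Sum>\<beta>\<in>?S. c (\<beta>(m := k)) * (\<Prod>i<m. f i x ^ \<beta> i))" for k x
    have g_poly: "g k \<in> poly_fun" for k
      unfolding g_def[abs_def] using f(1) m
      by (intro poly_fun_sum poly_fun.mult poly_fun.const poly_fun_prod poly_fun_power) auto
    have expand: "(\<Sum>\<alpha>\<in>{..<Suc m} \<rightarrow>\<^sub>E {..<K}. c \<alpha> * (\<Prod>i<Suc m. f i x ^ \<alpha> i))
        = (\<Sum>k<K. f m x ^ k * g k x)" for x
    proof -
      have "(\<Sum>\<alpha>\<in>{..<Suc m} \<rightarrow>\<^sub>E {..<K}. c \<alpha> * (\<Prod>i<Suc m. f i x ^ \<alpha> i))
        = (\<Sum>(k,\<beta>)\<in>{..<K} \<times> ?S. c (\<beta>(m := k)) * (\<Prod>i<Suc m. f i x ^ (\<beta>(m := k)) i))"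
        unfolding lessThan_Suc PiE_insert_eq
        by (subst sum.reindex[OF inj_combinator]) (auto simp: case_prod_unfold)
      also have "\<dots> = (\<Sum>(k,\<beta>)\<in>{..<K} \<times> ?S. f m x ^ k * (c (\<beta>(m := k)) * (\<Prod>i<m. f i x ^ \<beta> i)))"
        by (intro sum.cong refl) (auto simp: algebra_simps intro!: prod.cong)
      also have "\<dots> = (\<Sum>k<K. f m x ^ k * g k x)"
        by (simp add: g_def sum.cartesian_product[symmetric] sum_distrib_left)
      finally show ?thesis .
    qed
    obtain z where z: "z \<in> Z (Suc m)" "f m z \<noteq> 0" using f(3)[OF m] by auto
    \<comment> \<open>Strong induction on k: once the coefficients below k vanish,
      \<open>f m ^ k\<close> factors out of the relation, leaving the cofactor h.\<close>
    have g0: "c (\<beta>(m := k)) = 0" if "k < K" "\<beta> \<in> ?S" for k \<beta>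
      using that
    proof (induction k arbitrary: \<beta> rule: less_induct)
      case (less k)
      define h where "h x = (\<Sum>j\<in>{k..<K}. f m x ^ (j - k) * g j x)" for x
      have h_poly: "h \<in> poly_fun"
        unfolding h_def[abs_def] using f(1)[OF m] g_poly
        by (intro poly_fun_sum poly_fun.mult poly_fun_power) auto
      have "f m x ^ k * h x = 0" if "x \<in> Z (Suc m)" for x
      proof -
        have "g j x = 0" if "j < k" for j
          unfolding g_def using less.IH[OF that] that less.prems(1) by (intro sum.neutral) (simp del: fun_upd_apply)
        then have "(\<Sum>j<K. f m x ^ j * g j x) = (\<Sum>j\<in>{k..<K}. f m x ^ j * g j x)"
          by (intro sum.mono_neutral_right) auto
        also have "\<dots> = f m x ^ k * h x"
          unfolding h_def sum_distrib_left
          by (intro sum.cong refl) (auto simp: mult.assoc[symmetric] power_add[symmetric])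
        finally show ?thesis using c that expand by simp
      qed
      from zariski_irreducible_prime[OF _ poly_fun_power h_poly this z(1)]
      have "h x = 0" if "x \<in> Z (Suc m)" for x
        using that z(2) Z(1)[of "Suc m"] m f(1)[OF m] by simp
      \<comment> \<open>On \<open>Z m\<close> the function \<open>f m\<close> vanishes, so only the
        term j = k survives, with \<open>0 ^ 0 = 1\<close>.\<close>
      moreover have "h x = g k x" if "x \<in> Z m" for x
      proof -
        have "h x = f m x ^ (k - k) * g k x"
          unfolding h_def
          by (subst sum.mono_neutral_right[of _ "{k}"])
            (use less.prems(1) f(2)[OF m, of x] that in auto)
        then show ?thesis by simp
      qed
      ultimately have gk: "g k x = 0" if "x \<in> Z m" for x
        using that Z(2)[OF m] by (metis subsetD)
      have "\<forall>x\<in>Z m. (\<Sum>\<beta>\<in>?S. c (\<beta>(m := k)) * (\<Prod>i<m. f i x ^ \<beta> i)) = 0"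
        using gk by (simp add: g_def)
      then have "\<forall>\<beta>\<in>?S. c (\<beta>(m := k)) = 0" using m by (intro Suc.IH) (simp_all del: fun_upd_apply)
      then show ?case using less.prems(2) by blast
    qed
    show ?case
    proof
      fix \<alpha> assume \<alpha>: "\<alpha> \<in> {..<Suc m} \<rightarrow>\<^sub>E {..<K}"
      have "restrict \<alpha> {..<m} \<in> ?S" "\<alpha> m < K" using \<alpha> by (auto simp: PiE_iff)
      then have "c ((restrict \<alpha> {..<m})(m := \<alpha> m)) = 0" by (intro g0)
      moreover have "(restrict \<alpha> {..<m})(m := \<alpha> m) = \<alpha>"
        using \<alpha> by (auto simp: fun_eq_iff PiE_iff extensional_def less_Suc_eq)
      ultimately show "c \<alpha> = 0" by (simp only:)
    qed
  qed
  then show ?thesis using assms(8) by blast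
qed

section \<open>Dimension of polynomially parametrized sets\<close>

text \<open>
  Monomials with exponents below \<open>K\<close> in \<open>m\<close> functions on the parameter space are determined by their values on
  a grid with \<open>O(K ^ card J)\<close> points, so for \<open>m > card J\<close> they satisfy a linear relation once
  \<open>K\<close> is large.
\<close>

lemma irreducible_chain_length_le:
  fixes F :: "('j \<Rightarrow> real) \<Rightarrow> 'i \<Rightarrow> real"
  assumes J: "finite J"
    and F: "\<And>c. (\<lambda>x. F x c) \<in> poly_fun" "\<And>x. F (\<lambda>c. if c \<in> J then x c else 0) = F x"
    and X: "X \<subseteq> zariski_closure (range F)"
    and Z: "\<And>i. i \<le> m \<Longrightarrow> zariski_irreducible (Z i)" "\<And>i. i \<le> m \<Longrightarrow> Z i \<subseteq> X"
      "\<And>i. i < m \<Longrightarrow> Z i \<subset> Z (Suc i)"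
  shows "m \<le> card J"
proof (rule ccontr)
  assume "\<not> m \<le> card J"
  then have m: "Suc (card J) \<le> m" by simp
  have "\<exists>f. f \<in> poly_fun \<and> (\<forall>x\<in>Z i. f x = 0) \<and> (\<exists>x\<in>Z (Suc i). f x \<noteq> 0)" if i: "i < m" for i
  proof -
    obtain x where x: "x \<in> Z (Suc i)" "x \<notin> Z i" using Z(3)[OF i] by blast
    have "zariski_closed (Z i)" using Z(1)[of i] i by (simp add: zariski_irreducible_def)
    from zariski_closed_separation[OF this x(2)] show ?thesis using x(1) by metis
  qed
  then obtain f where f: "\<And>i. i < m \<Longrightarrow> f i \<in> poly_fun" "\<And>i x. i < m \<Longrightarrow> x \<in> Z i \<Longrightarrow> f i x = 0"
    "\<And>i. i < m \<Longrightarrow> \<exists>x\<in>Z (Suc i). f i x \<noteq> 0" by metis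
  have "\<exists>D. \<forall>c x. \<exists>q. degree q \<le> D \<and> (\<forall>t. f i (F (x(c := t))) = poly q t)" if "i < m" for i
    using poly_fun_degree_bound[OF poly_fun_compose[of "f i" F, OF f(1)[OF that] F(1)]] .
  then obtain D where
    D: "\<And>i. i < m \<Longrightarrow> \<forall>c x. \<exists>q. degree q \<le> D i \<and> (\<forall>t. f i (F (x(c := t))) = poly q t)" by metis
  \<comment> \<open>A monomial with exponents below K has degree at most L = K E in each coordinate.
    K exceeds \<open>(E + 1) ^ card J\<close>, so the grid has fewer than
    \<open>K ^ Suc (card J)\<close> points.\<close>
  define E where "E = (\<Sum>i<m. D i)"
  define K where "K = Suc ((E + 1) ^ card J)"
  define L where "L = K * E"
  let ?A = "{..<m} \<rightarrow>\<^sub>E {..<K}"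
  let ?grid = "(\<lambda>\<gamma> c. if c \<in> J then real (\<gamma> c) else 0) ` (J \<rightarrow>\<^sub>E {..L})"
  have fin: "finite ?A" "finite ?grid" using J by (auto intro!: finite_PiE)
  have "card ?grid \<le> card (J \<rightarrow>\<^sub>E {..L})" using J by (intro card_image_le finite_PiE) auto
  also have "\<dots> = (L + 1) ^ card J" using J by (simp add: card_PiE)
  also have "\<dots> \<le> (K * (E + 1)) ^ card J" by (intro power_mono) (auto simp: L_def K_def)
  also have "\<dots> = K ^ card J * (E + 1) ^ card J" by (rule power_mult_distrib)
  also have "\<dots> < K ^ card J * K" by (simp add: K_def)
  also have "\<dots> = K ^ Suc (card J)" by simp
  also have "\<dots> \<le> K ^ m" using m by (intro power_increasing) (auto simp: K_def)
  also have "\<dots> = card ?A" by (simp add: card_PiE)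
  finally have "card ?grid < card ?A" .
  \<comment> \<open>The unknowns are the coefficients of the monomials, the equations say that the
    combination vanishes at the grid points.\<close>
  from underdetermined_system[OF fin(2,1) this, of "\<lambda>\<alpha> y. \<Prod>i<m. f i (F y) ^ \<alpha> i"]
  obtain c where c: "\<exists>\<alpha>\<in>?A. c \<alpha> \<noteq> 0"
    "\<forall>y\<in>?grid. (\<Sum>\<alpha>\<in>?A. c \<alpha> * (\<Prod>i<m. f i (F y) ^ \<alpha> i)) = 0"
    by (elim exE conjE)
  define g where "g y = (\<Sum>\<alpha>\<in>?A. c \<alpha> * (\<Prod>i<m. f i y ^ \<alpha> i))" for y
  have g_poly: "g \<in> poly_fun"
    unfolding g_def[abs_def] using f(1)
    by (intro poly_fun_sum poly_fun.mult poly_fun.const poly_fun_prod poly_fun_power) auto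
  have deg: "\<exists>q. degree q \<le> L \<and> (\<forall>t. g (F (x(d := t))) = poly q t)" for d x
  proof -
    have "\<forall>i. \<exists>q. i < m \<longrightarrow> degree q \<le> D i \<and> (\<forall>t. f i (F (x(d := t))) = poly q t)"
      using D by blast
    then obtain q where
      "\<forall>i. i < m \<longrightarrow> degree (q i) \<le> D i \<and> (\<forall>t. f i (F (x(d := t))) = poly (q i) t)"
      by (rule exE[OF choice])
    then have q: "\<And>i. i < m \<Longrightarrow> degree (q i) \<le> D i"
      "\<And>i t. i < m \<Longrightarrow> f i (F (x(d := t))) = poly (q i) t" by auto
    let ?Q = "\<Sum>\<alpha>\<in>?A. smult (c \<alpha>) (\<Prod>i<m. q i ^ \<alpha> i)"
    have "degree (smult (c \<alpha>) (\<Prod>i<m. q i ^ \<alpha> i)) \<le> L" if \<alpha>: "\<alpha> \<in> ?A" for \<alpha>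
    proof -
      have "degree (\<Prod>i<m. q i ^ \<alpha> i) \<le> (\<Sum>i<m. degree (q i ^ \<alpha> i))"
        using degree_prod_sum_le[of "{..<m}" "\<lambda>i. q i ^ \<alpha> i"] by (simp add: o_def)
      also have "\<dots> \<le> (\<Sum>i<m. K * D i)"
      proof (rule sum_mono)
        fix i assume i: "i \<in> {..<m}"
        have "degree (q i ^ \<alpha> i) \<le> degree (q i) * \<alpha> i" by (rule degree_power_le)
        also have "\<dots> \<le> D i * K" using q(1)[of i] \<alpha> i by (intro mult_mono) (auto simp: PiE_iff less_imp_le)
        finally show "degree (q i ^ \<alpha> i) \<le> K * D i" by (simp add: mult.commute)
      qed
      also have "\<dots> = L" by (simp add: L_def E_def sum_distrib_left)
      finally show ?thesis using degree_smult_le order_trans by blast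
    qed
    then have "degree ?Q \<le> L" using fin(1) by (intro degree_sum_le) auto
    moreover have "g (F (x(d := t))) = poly ?Q t" for t
      using q(2) by (simp add: g_def poly_sum poly_prod)
    ultimately show ?thesis by blast
  qed
  have g0: "g (F y) = 0" for y
  proof -
    let ?y = "\<lambda>c. if c \<in> J then y c else 0"
    have "g (F ?y) = 0"
    proof (rule zero_if_zero_on_grid[where h = "\<lambda>x. g (F x)" and J = J and L = L])
      fix x :: "'j \<Rightarrow> real"
      assume x: "\<And>c. c \<in> J \<Longrightarrow> x c \<in> real ` {..L}" "\<And>c. c \<notin> J \<Longrightarrow> x c = ?y c"
      then obtain \<gamma> where \<gamma>: "\<And>c. c \<in> J \<Longrightarrow> \<gamma> c \<le> L \<and> x c = real (\<gamma> c)"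
        unfolding image_iff by (metis atMost_iff)
      have "x \<in> ?grid"
        using x(2) \<gamma> by (intro image_eqI[of _ _ "restrict \<gamma> J"]) (auto simp: fun_eq_iff)
      from bspec[OF c(2) this] show "g (F x) = 0" by (simp add: g_def)
    qed (use J deg in auto)
    then show ?thesis using F(2)[of y] by simp
  qed
  \<comment> \<open>Having zero pullback, g vanishes on the image of F and hence on its closure,
    which contains \<open>Z m\<close>.\<close>
  have "\<forall>x\<in>Z m. g x = 0"
  proof
    fix x assume "x \<in> Z m"
    then have "x \<in> zariski_closure (range F)" using Z(2)[of m] X by auto
    from zero_on_zariski_closure[OF g_poly _ this] show "g x = 0" using g0 by blast
  qed
  then have "\<forall>x\<in>Z m. (\<Sum>\<alpha>\<in>?A. c \<alpha> * (\<Prod>i<m. f i x ^ \<alpha> i)) = 0" by (simp add: g_def)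
  then have "c \<alpha> = 0" if "\<alpha> \<in> ?A" for \<alpha>
    using Z(1,3) f that
    by (intro chain_monomials_independent[where M = m and m = m and Z = Z and f = f and K = K and c = c and \<alpha> = \<alpha>])
      (simp_all add: psubset_imp_subset)
  then show False using c(1) by blast
qed

text \<open>Strictness comes from w: vanishing on the image of one coordinate subspace passes to the
  closure, while w is nonzero at an image point of the next subspace.\<close>

lemma irreducible_flag:
  fixes F :: "('j \<Rightarrow> real) \<Rightarrow> 'i \<Rightarrow> real"
  assumes F: "\<And>c. (\<lambda>x. F x c) \<in> poly_fun" and X: "zariski_closed X" "range F \<subseteq> X"
    and sep: "\<And>i. i < length xs \<Longrightarrow> \<exists>w\<in>poly_fun.
      (\<forall>x. (\<forall>c. c \<notin> set (take i xs) \<longrightarrow> x c = 0) \<longrightarrow> w (F x) = 0) \<and>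
      (\<exists>x. (\<forall>c. c \<notin> set (take (Suc i) xs) \<longrightarrow> x c = 0) \<and> w (F x) \<noteq> 0)"
  shows "\<exists>Z. (\<forall>i\<le>length xs. zariski_irreducible (Z i) \<and> Z i \<subseteq> X) \<and>
    (\<forall>i<length xs. Z i \<subset> Z (Suc i))"
proof -
  \<comment> \<open>\<open>R i\<close> projects onto the subspace of the first i coordinates, so
    \<open>Z i\<close> is the closure of the polynomial image of a whole affine space and hence
    irreducible.\<close>
  define R where "R i x = (\<lambda>c. if c \<in> set (take i xs) then x c else (0::real))" for i x
  define Z where "Z i = zariski_closure (range (\<lambda>x. F (R i x)))" for i
  have R_poly: "(\<lambda>x. R i x c) \<in> poly_fun" for i c
    by (cases "c \<in> set (take i xs)") (auto simp: R_def intro: poly_fun.const poly_fun.var)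
  have "(\<lambda>x. F (R i x) c) \<in> poly_fun" for i c
    using poly_fun_compose[of "\<lambda>x. F x c" "R i"] F R_poly by blast
  then have irr: "zariski_irreducible (Z i)" for i
    unfolding Z_def by (intro zariski_irreducible_closure_range)
  have sub: "Z i \<subseteq> X" for i
    unfolding Z_def using X by (intro zariski_closure_minimal) auto
  have strict: "Z i \<subset> Z (Suc i)" if i: "i < length xs" for i
  proof -
    have "R i x = R (Suc i) (R i x)" for x
      using set_take_subset_set_take[of i "Suc i" xs] by (auto simp: R_def fun_eq_iff)
    then have "range (\<lambda>x. F (R i x)) \<subseteq> range (\<lambda>x. F (R (Suc i) x))" by (metis image_subsetI rangeI)
    then have "Z i \<subseteq> Z (Suc i)" unfolding Z_def by (rule zariski_closure_mono)
    moreover from sep[OF i] obtain w where w: "w \<in> poly_fun" and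
      w12: "(\<forall>x. (\<forall>c. c \<notin> set (take i xs) \<longrightarrow> x c = 0) \<longrightarrow> w (F x) = 0) \<and>
        (\<exists>x. (\<forall>c. c \<notin> set (take (Suc i) xs) \<longrightarrow> x c = 0) \<and> w (F x) \<noteq> 0)"
      by (rule bexE)
    moreover from w12 obtain x where x: "\<forall>c. c \<notin> set (take (Suc i) xs) \<longrightarrow> x c = 0" "w (F x) \<noteq> 0"
      by (elim conjE exE)
    have "w (F (R i x)) = 0" for x using w12 by (simp add: R_def)
    then have "w y = 0" if "y \<in> Z i" for y
      using that zero_on_zariski_closure[OF w, of "range (\<lambda>x. F (R i x))" y] unfolding Z_def by blast
    then have "F x \<notin> Z i" using x(2) by blast
    moreover have "F x \<in> Z (Suc i)"
    proof -
      have "R (Suc i) x = x" using x(1) by (auto simp: R_def fun_eq_iff)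
      then have "F x \<in> range (\<lambda>x. F (R (Suc i) x))" using rangeI[of "\<lambda>x. F (R (Suc i) x)" x] by simp
      then show ?thesis unfolding Z_def by (rule subsetD[OF zariski_closure_subset])
    qed
    ultimately show ?thesis by blast
  qed
  show ?thesis using irr sub strict by blast
qed

text \<open>The flag attains the length and the bound on chains excludes anything longer, so the
  \<open>Sup\<close> is a maximum.\<close>

lemma zariski_dim_eqI:
  fixes F :: "('j \<Rightarrow> real) \<Rightarrow> 'i \<Rightarrow> real"
  assumes "distinct xs"
    and F: "\<And>c. (\<lambda>x. F x c) \<in> poly_fun" "\<And>x. F (\<lambda>c. if c \<in> set xs then x c else 0) = F x"
    and X: "zariski_closed X" "range F \<subseteq> X" "X \<subseteq> zariski_closure (range F)"
    and sep: "\<And>i. i < length xs \<Longrightarrow> \<exists>w\<in>poly_fun.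
      (\<forall>x. (\<forall>c. c \<notin> set (take i xs) \<longrightarrow> x c = 0) \<longrightarrow> w (F x) = 0) \<and>
      (\<exists>x. (\<forall>c. c \<notin> set (take (Suc i) xs) \<longrightarrow> x c = 0) \<and> w (F x) \<noteq> 0)"
  shows "zariski_dim X = length xs"
  unfolding zariski_dim_def
proof (rule cSup_eq_maximum)
  show "length xs \<in> {m. \<exists>Z. (\<forall>i\<le>m. zariski_irreducible (Z i) \<and> Z i \<subseteq> X) \<and> (\<forall>i<m. Z i \<subset> Z (Suc i))}"
    using irreducible_flag[OF F(1) X(1,2) sep] by simp
  fix m assume "m \<in> {m. \<exists>Z. (\<forall>i\<le>m. zariski_irreducible (Z i) \<and> Z i \<subseteq> X) \<and> (\<forall>i<m. Z i \<subset> Z (Suc i))}"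
  then obtain Z where "\<forall>i\<le>m. zariski_irreducible (Z i) \<and> Z i \<subseteq> X" "\<forall>i<m. Z i \<subset> Z (Suc i)" by blast
  then have "m \<le> card (set xs)"
    by (intro irreducible_chain_length_le[OF _ F X(3), of m Z]) auto
  then show "m \<le> length xs" using distinct_card[OF assms(1)] by simp
qed

section \<open>Moments of Gaussian mixtures\<close>

text \<open>For symmetric \<Sigma> this is the gradient in u of the exponent of component i.\<close>

definition tilted_mean :: "('n::finite, 'k) hparam \<Rightarrow> 'k \<Rightarrow> ('n \<Rightarrow> real) \<Rightarrow> 'n \<Rightarrow> real" where
  "tilted_mean \<theta> i u j = hmu \<theta> i j + (\<Sum>l\<in>UNIV. hSigma \<theta> j l * u l)"

definition component_mgf :: "('n::finite, 'k) hparam \<Rightarrow> 'k \<Rightarrow> ('n \<Rightarrow> real) \<Rightarrow> real" where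
  "component_mgf \<theta> i u =
    exp ((\<Sum>j\<in>UNIV. u j * hmu \<theta> i j) + 1/2 * (\<Sum>j\<in>UNIV. \<Sum>l\<in>UNIV. u j * hSigma \<theta> j l * u l))"

lemma tilted_mean_0: "tilted_mean \<theta> i (\<lambda>_. 0) = hmu \<theta> i"
  by (simp add: tilted_mean_def fun_eq_iff)

lemma component_mgf_0: "component_mgf \<theta> i (\<lambda>_. 0) = 1"
  by (simp add: component_mgf_def)

lemma tilted_mean_shift:
  "tilted_mean \<theta> i (u(k := u k + t)) = (\<lambda>j. tilted_mean \<theta> i u j + t * hSigma \<theta> j k)"
proof
  fix j
  have "(\<Sum>l\<in>UNIV. hSigma \<theta> j l * (u(k := u k + t)) l)
      = (\<Sum>l\<in>UNIV. hSigma \<theta> j l * u l + (if l = k then hSigma \<theta> j k * t else 0))"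
    by (intro sum.cong) (auto simp: algebra_simps)
  then show "tilted_mean \<theta> i (u(k := u k + t)) j = tilted_mean \<theta> i u j + t * hSigma \<theta> j k"
    by (simp add: tilted_mean_def sum.distrib)
qed

lemma component_mgf_deriv:
  assumes sym: "\<And>j l. hSigma \<theta> j l = hSigma \<theta> l j"
  shows "((\<lambda>t. component_mgf \<theta> i (u(k := u k + t))) has_real_derivative
    tilted_mean \<theta> i u k * component_mgf \<theta> i u) (at 0)"
proof -
  have coord: "((\<lambda>t. (u(k := u k + t)) j) has_real_derivative (if j = k then 1 else 0)) (at 0)" for j
    by (cases "j = k") (auto intro!: derivative_eq_intros)
  have "((\<lambda>t. component_mgf \<theta> i (u(k := u k + t))) has_real_derivative
    component_mgf \<theta> i (u(k := u k + 0)) *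
    ((\<Sum>j\<in>UNIV. (if j = k then 1 else 0) * hmu \<theta> i j) + 1/2 * (\<Sum>j\<in>UNIV. \<Sum>l\<in>UNIV.
      (if j = k then 1 else 0) * hSigma \<theta> j l * u l + u j * hSigma \<theta> j l * (if l = k then 1 else 0)))) (at 0)"
    unfolding component_mgf_def
    by (rule derivative_eq_intros coord refl)+ (simp add: algebra_simps)
  moreover have "(\<Sum>j\<in>UNIV. (if j = k then 1 else 0) * hmu \<theta> i j) = hmu \<theta> i k"
    by (simp add: if_distrib[of "\<lambda>x. x * _"] cong: if_cong)
  moreover have "(\<Sum>j\<in>UNIV. \<Sum>l\<in>UNIV.
      (if j = k then 1 else 0) * hSigma \<theta> j l * u l + u j * hSigma \<theta> j l * (if l = k then 1 else 0))
      = 2 * (\<Sum>l\<in>UNIV. hSigma \<theta> k l * u l)"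
  proof -
    have "(\<Sum>j\<in>UNIV. \<Sum>l\<in>UNIV. (if j = k then 1 else 0) * hSigma \<theta> j l * u l)
        = (\<Sum>j\<in>UNIV. if j = k then (\<Sum>l\<in>UNIV. hSigma \<theta> j l * u l) else 0)"
      by (intro sum.cong) auto
    moreover have "(\<Sum>j\<in>UNIV. \<Sum>l\<in>UNIV. u j * hSigma \<theta> j l * (if l = k then 1 else 0))
        = (\<Sum>j\<in>UNIV. hSigma \<theta> k j * u j)"
      by (intro sum.cong) (auto simp: sym[of _ k] if_distrib[of "\<lambda>x. _ * x"] cong: if_cong)
    ultimately show ?thesis by (simp add: sum.distrib)
  qed
  ultimately show ?thesis by (simp add: tilted_mean_def mult.commute)
qed

text \<open>Product rule: the exponential brings down coordinate k of the tilted mean, and the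
  tilted mean moves along column k of \<Sigma>. The shape of the sum is preserved, so the rule can
  be iterated.\<close>

lemma pdiff_mixture:
  fixes \<theta> :: "('n::finite, 'k::finite) hparam"
  assumes \<theta>: "\<theta> \<in> Theta_H"
    and g: "g = (\<lambda>u. \<Sum>i\<in>UNIV. hlam \<theta> i * Q (tilted_mean \<theta> i u) * component_mgf \<theta> i u)"
    and Q: "\<And>v. ((\<lambda>t. Q (\<lambda>j. v j + t * hSigma \<theta> j k)) has_real_derivative Q' v) (at 0)"
  shows "pdiff k g = (\<lambda>u. \<Sum>i\<in>UNIV. hlam \<theta> i *
    (tilted_mean \<theta> i u k * Q (tilted_mean \<theta> i u) + Q' (tilted_mean \<theta> i u)) * component_mgf \<theta> i u)"
proof
  fix u
  have sym: "\<And>j l. hSigma \<theta> j l = hSigma \<theta> l j" using \<theta> by (auto simp: Theta_H_def)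
  have "((\<lambda>t. g (u(k := u k + t))) has_real_derivative (\<Sum>i\<in>UNIV. hlam \<theta> i *
    (tilted_mean \<theta> i u k * Q (tilted_mean \<theta> i u) + Q' (tilted_mean \<theta> i u)) * component_mgf \<theta> i u)) (at 0)"
    unfolding g tilted_mean_shift
    by (rule derivative_eq_intros component_mgf_deriv[OF sym] Q refl)+ (simp add: algebra_simps)
  then show "pdiff k g u = (\<Sum>i\<in>UNIV. hlam \<theta> i *
    (tilted_mean \<theta> i u k * Q (tilted_mean \<theta> i u) + Q' (tilted_mean \<theta> i u)) * component_mgf \<theta> i u)"
    unfolding pdiff_def by (rule DERIV_imp_deriv)
qed

lemma mgf_mixture:
  "mgf \<theta> = (\<lambda>u. \<Sum>i\<in>UNIV. hlam \<theta> i * 1 * component_mgf \<theta> i u)"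
  by (simp add: mgf_def component_mgf_def fun_eq_iff)

text \<open>\<open>Inl (j, l)\<close> stands for an entry of \<Sigma> and \<open>Inr j\<close> for
  one of the tilted mean. With \<Sigma> among the variables, Q and its derivative do not depend on
  the parameter.\<close>

lemma poly_fun_directional_derivative:
  fixes Q :: "('n \<times> 'n + 'n \<Rightarrow> real) \<Rightarrow> real"
  assumes "Q \<in> poly_fun"
  shows "\<exists>Q'\<in>poly_fun. \<forall>S v. ((\<lambda>t. Q (case_sum S (\<lambda>j. v j + t * S (j, k)))) has_real_derivative
    Q' (case_sum S v)) (at 0)"
  using assms
proof induction
  case (const c)
  show ?case by (rule bexI[of _ "\<lambda>_. 0"]) (auto intro: poly_fun.const)
next
  case (var i)
  show ?case
  proof (cases i)
    case (Inl p)
    then show ?thesis by (intro bexI[of _ "\<lambda>_. 0"]) (auto intro: poly_fun.const)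
  next
    case (Inr j)
    then show ?thesis
      by (intro bexI[of _ "\<lambda>x. x (Inl (j, k))"]) (auto intro!: poly_fun.var derivative_eq_intros)
  qed
next
  case (add p q)
  then obtain p' q' where "p' \<in> poly_fun" "q' \<in> poly_fun"
    "\<And>S v. ((\<lambda>t. p (case_sum S (\<lambda>j. v j + t * S (j, k)))) has_real_derivative p' (case_sum S v)) (at 0)"
    "\<And>S v. ((\<lambda>t. q (case_sum S (\<lambda>j. v j + t * S (j, k)))) has_real_derivative q' (case_sum S v)) (at 0)"
    by blast
  then show ?case
    by (intro bexI[of _ "\<lambda>x. p' x + q' x"]) (auto intro: poly_fun.add DERIV_add)
next
  case (mult p q)
  then obtain p' q' where pq: "p' \<in> poly_fun" "q' \<in> poly_fun"
    "\<And>S v. ((\<lambda>t. p (case_sum S (\<lambda>j. v j + t * S (j, k)))) has_real_derivative p' (case_sum S v)) (at 0)"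
    "\<And>S v. ((\<lambda>t. q (case_sum S (\<lambda>j. v j + t * S (j, k)))) has_real_derivative q' (case_sum S v)) (at 0)"
    by blast
  show ?case
  proof (intro bexI[of _ "\<lambda>x. p' x * q x + q' x * p x"] allI)
    show "(\<lambda>x. p' x * q x + q' x * p x) \<in> poly_fun"
      using pq(1,2) mult.hyps by (intro poly_fun.add poly_fun.mult)
    show "((\<lambda>t. p (case_sum S (\<lambda>j. v j + t * S (j, k))) * q (case_sum S (\<lambda>j. v j + t * S (j, k))))
      has_real_derivative p' (case_sum S v) * q (case_sum S v) + q' (case_sum S v) * p (case_sum S v)) (at 0)" for S v
      using DERIV_mult[OF pq(3)[of S v] pq(4)[of S v]] by simp
  qed
qed

lemma pdiffs_mgf_poly:
  "\<exists>Q\<in>poly_fun. \<forall>\<theta>\<in>(Theta_H :: ('n::finite, 'k::finite) hparam set). pdiffs js (mgf \<theta>) =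
    (\<lambda>u. \<Sum>i\<in>UNIV. hlam \<theta> i * Q (case_sum (\<lambda>(j, l). hSigma \<theta> j l) (tilted_mean \<theta> i u)) * component_mgf \<theta> i u)"
proof (induction js)
  case Nil
  show ?case by (intro bexI[of _ "\<lambda>_. 1"]) (auto simp: mgf_mixture intro: poly_fun.const)
next
  case (Cons k js)
  then obtain Q where Q: "Q \<in> poly_fun" "\<And>\<theta>. \<theta> \<in> (Theta_H :: ('n, 'k) hparam set) \<Longrightarrow> pdiffs js (mgf \<theta>) =
    (\<lambda>u. \<Sum>i\<in>UNIV. hlam \<theta> i * Q (case_sum (\<lambda>(j, l). hSigma \<theta> j l) (tilted_mean \<theta> i u)) * component_mgf \<theta> i u)"
    by blast
  obtain Q' where Q': "Q' \<in> poly_fun" "\<And>S v. ((\<lambda>t. Q (case_sum S (\<lambda>j. v j + t * S (j, k)))) has_real_derivative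
    Q' (case_sum S v)) (at 0)"
    using poly_fun_directional_derivative[OF Q(1), of k] by blast
  show ?case
  proof (intro bexI[of _ "\<lambda>x. x (Inr k) * Q x + Q' x"] ballI)
    show "(\<lambda>x. x (Inr k) * Q x + Q' x) \<in> poly_fun"
      using Q(1) Q'(1) by (intro poly_fun.add poly_fun.mult poly_fun.var)
    fix \<theta> :: "('n, 'k) hparam" assume \<theta>: "\<theta> \<in> Theta_H"
    let ?S = "\<lambda>(j, l). hSigma \<theta> j l"
    show "pdiffs (k # js) (mgf \<theta>) = (\<lambda>u. \<Sum>i\<in>UNIV. hlam \<theta> i *
        (case_sum ?S (tilted_mean \<theta> i u) (Inr k) * Q (case_sum ?S (tilted_mean \<theta> i u)) +
         Q' (case_sum ?S (tilted_mean \<theta> i u))) * component_mgf \<theta> i u)"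
      unfolding pdiffs.simps(2) sum.case(2)
      by (rule pdiff_mixture[where Q = "\<lambda>v. Q (case_sum ?S v)" and Q' = "\<lambda>v. Q' (case_sum ?S v)",
            OF \<theta> Q(2)[OF \<theta>]])
        (use Q'(2)[of ?S] in simp)
  qed
qed

text \<open>At u = 0 these are the raw Gaussian moments of the components, averaged with the
  weights. Orders four and five are needed in a single direction only.\<close>

lemma pdiffs_mgf_low_order:
  fixes \<theta> :: "('n::finite, 'k::finite) hparam"
  assumes \<theta>: "\<theta> \<in> Theta_H"
  defines "E \<equiv> \<lambda>P. \<Sum>i\<in>UNIV. hlam \<theta> i * P (hmu \<theta> i)"
    and "S \<equiv> hSigma \<theta>"
  shows "pdiffs [a] (mgf \<theta>) (\<lambda>_. 0) = E (\<lambda>v. v a)"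
    and "pdiffs [b, a] (mgf \<theta>) (\<lambda>_. 0) = E (\<lambda>v. v a * v b + S a b)"
    and "pdiffs [c, b, a] (mgf \<theta>) (\<lambda>_. 0) = E (\<lambda>v. v a * v b * v c + S a b * v c + S a c * v b + S b c * v a)"
    and "pdiffs [a, a, a, a] (mgf \<theta>) (\<lambda>_. 0) = E (\<lambda>v. v a ^ 4 + 6 * S a a * v a ^ 2 + 3 * S a a ^ 2)"
    and "pdiffs [a, a, a, a, a] (mgf \<theta>) (\<lambda>_. 0) =
      E (\<lambda>v. v a ^ 5 + 10 * S a a * v a ^ 3 + 15 * S a a ^ 2 * v a)"
proof -
  have p1: "pdiffs [a] (mgf \<theta>) = (\<lambda>u. \<Sum>i\<in>UNIV. hlam \<theta> i * (tilted_mean \<theta> i u a) * component_mgf \<theta> i u)" for a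
    using pdiff_mixture[where k = a and Q = "\<lambda>v. 1" and Q' = "\<lambda>v. 0", OF \<theta> mgf_mixture] by simp
  have p2: "pdiffs [b, a] (mgf \<theta>) = (\<lambda>u. \<Sum>i\<in>UNIV. hlam \<theta> i *
      (tilted_mean \<theta> i u b * tilted_mean \<theta> i u a + S a b) * component_mgf \<theta> i u)" for a b
    unfolding pdiffs.simps(2)[of b "[a]"] S_def
    by (rule pdiff_mixture[where Q = "\<lambda>v. v a" and Q' = "\<lambda>v. hSigma \<theta> a b", OF \<theta> p1])
      (auto intro!: derivative_eq_intros)
  have p3: "pdiffs [c, b, a] (mgf \<theta>) = (\<lambda>u. \<Sum>i\<in>UNIV. hlam \<theta> i *
      (tilted_mean \<theta> i u c * (tilted_mean \<theta> i u b * tilted_mean \<theta> i u a + S a b) +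
        (S b c * tilted_mean \<theta> i u a + S a c * tilted_mean \<theta> i u b)) * component_mgf \<theta> i u)" for a b c
    unfolding pdiffs.simps(2)[of c "[b, a]"]
    by (rule pdiff_mixture[where Q = "\<lambda>v. v b * v a + S a b" and
          Q' = "\<lambda>v. S b c * v a + S a c * v b", OF \<theta> p2])
      (auto intro!: derivative_eq_intros simp: S_def)
  \<comment> \<open>Equal indices collapse the third derivative to a polynomial in one coordinate,
    which keeps the next two short.\<close>
  have p3': "pdiffs [a, a, a] (mgf \<theta>) = (\<lambda>u. \<Sum>i\<in>UNIV. hlam \<theta> i *
      (tilted_mean \<theta> i u a ^ 3 + 3 * S a a * tilted_mean \<theta> i u a) * component_mgf \<theta> i u)" for a
    unfolding p3 by (intro ext sum.cong) (auto simp: algebra_simps power3_eq_cube)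
  have p4: "pdiffs [a, a, a, a] (mgf \<theta>) = (\<lambda>u. \<Sum>i\<in>UNIV. hlam \<theta> i *
      (tilted_mean \<theta> i u a * (tilted_mean \<theta> i u a ^ 3 + 3 * S a a * tilted_mean \<theta> i u a) +
        (3 * tilted_mean \<theta> i u a ^ 2 * S a a + 3 * S a a ^ 2)) * component_mgf \<theta> i u)" for a
    unfolding pdiffs.simps(2)[of a "[a, a, a]"]
    by (rule pdiff_mixture[where Q = "\<lambda>v. v a ^ 3 + 3 * S a a * v a" and
          Q' = "\<lambda>v. 3 * v a ^ 2 * S a a + 3 * S a a ^ 2", OF \<theta> p3'])
      (auto intro!: derivative_eq_intros simp: S_def power2_eq_square algebra_simps)
  have p4': "pdiffs [a, a, a, a] (mgf \<theta>) = (\<lambda>u. \<Sum>i\<in>UNIV. hlam \<theta> i *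
      (tilted_mean \<theta> i u a ^ 4 + 6 * S a a * tilted_mean \<theta> i u a ^ 2 + 3 * S a a ^ 2) * component_mgf \<theta> i u)" for a
    unfolding p4 by (intro ext sum.cong) (auto simp: algebra_simps eval_nat_numeral)
  have p5: "pdiffs [a, a, a, a, a] (mgf \<theta>) = (\<lambda>u. \<Sum>i\<in>UNIV. hlam \<theta> i *
      (tilted_mean \<theta> i u a * (tilted_mean \<theta> i u a ^ 4 + 6 * S a a * tilted_mean \<theta> i u a ^ 2 + 3 * S a a ^ 2) +
        (4 * tilted_mean \<theta> i u a ^ 3 * S a a + 12 * S a a ^ 2 * tilted_mean \<theta> i u a)) * component_mgf \<theta> i u)" for a
    unfolding pdiffs.simps(2)[of a "[a, a, a, a]"]
    by (rule pdiff_mixture[where Q = "\<lambda>v. v a ^ 4 + 6 * S a a * v a ^ 2 + 3 * S a a ^ 2" and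
          Q' = "\<lambda>v. 4 * v a ^ 3 * S a a + 12 * S a a ^ 2 * v a", OF \<theta> p4'])
      (auto intro!: derivative_eq_intros simp: S_def power2_eq_square algebra_simps)
  note at_0 = tilted_mean_0 component_mgf_0 mult_1_right
  show "pdiffs [a] (mgf \<theta>) (\<lambda>_. 0) = E (\<lambda>v. v a)"
    unfolding p1 E_def at_0 by simp
  show "pdiffs [b, a] (mgf \<theta>) (\<lambda>_. 0) = E (\<lambda>v. v a * v b + S a b)"
    unfolding p2 E_def at_0 by (simp add: mult.commute)
  show "pdiffs [c, b, a] (mgf \<theta>) (\<lambda>_. 0) = E (\<lambda>v. v a * v b * v c + S a b * v c + S a c * v b + S b c * v a)"
    unfolding p3 E_def at_0 by (intro sum.cong) (auto simp: algebra_simps)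
  show "pdiffs [a, a, a, a] (mgf \<theta>) (\<lambda>_. 0) = E (\<lambda>v. v a ^ 4 + 6 * S a a * v a ^ 2 + 3 * S a a ^ 2)"
    unfolding p4 E_def at_0 by (intro sum.cong) (auto simp: algebra_simps eval_nat_numeral)
  show "pdiffs [a, a, a, a, a] (mgf \<theta>) (\<lambda>_. 0) =
      E (\<lambda>v. v a ^ 5 + 10 * S a a * v a ^ 3 + 15 * S a a ^ 2 * v a)"
    unfolding p5 E_def at_0 by (intro sum.cong) (auto simp: algebra_simps eval_nat_numeral)
qed

text \<open>\<open>moment\<close> differentiates along a list chosen by \<open>SOME\<close>, so only
  the multiset of its indices is known.\<close>

lemma moment_eq_pdiffs:
  "\<exists>js. mset js = mset js0 \<and> moment (count_list js0) \<theta> = pdiffs js (mgf \<theta>) (\<lambda>_. 0)"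
proof -
  let ?P = "\<lambda>js. \<forall>j. count_list js j = count_list js0 j"
  have "?P (SOME js. ?P js)" by (rule someI[of ?P js0]) simp
  then have "mset (SOME js. ?P js) = mset js0" by (intro multiset_eqI) (simp add: count_mset)
  then show ?thesis unfolding moment_def by blast
qed

text \<open>Every arrangement of the index list is checked against the formula, which takes the
  place of the symmetry of mixed partial derivatives.\<close>

lemma moment_low_order:
  fixes \<theta> :: "('n::finite, 'k::finite) hparam"
  assumes \<theta>: "\<theta> \<in> Theta_H"
  defines "E \<equiv> \<lambda>P. \<Sum>i\<in>UNIV. hlam \<theta> i * P (hmu \<theta> i)"
    and "S \<equiv> hSigma \<theta>"
  shows "moment (count_list [a]) \<theta> = E (\<lambda>v. v a)"
    and "moment (count_list [a, b]) \<theta> = E (\<lambda>v. v a * v b + S a b)"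
    and "moment (count_list [a, a, b]) \<theta> = E (\<lambda>v. v a ^ 2 * v b + S a a * v b + 2 * S a b * v a)"
    and "moment (count_list [a, a, a, a]) \<theta> = E (\<lambda>v. v a ^ 4 + 6 * S a a * v a ^ 2 + 3 * S a a ^ 2)"
    and "moment (count_list [a, a, a, a, a]) \<theta> =
      E (\<lambda>v. v a ^ 5 + 10 * S a a * v a ^ 3 + 15 * S a a ^ 2 * v a)"
proof -
  note low = pdiffs_mgf_low_order[OF \<theta>]
  have sym: "S j l = S l j" for j l using \<theta> by (auto simp: S_def Theta_H_def)
  show "moment (count_list [a]) \<theta> = E (\<lambda>v. v a)"
    using moment_eq_pdiffs[of "[a]" \<theta>] low(1) by (auto simp: E_def)
  obtain js where js: "mset js = mset [a, b]" "moment (count_list [a, b]) \<theta> = pdiffs js (mgf \<theta>) (\<lambda>_. 0)"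
    using moment_eq_pdiffs[of "[a, b]" \<theta>] by blast
  have "length js = 2" using mset_eq_length[OF js(1)] by simp
  then obtain x y where "js = [x, y]" by (auto simp: length_Suc_conv numeral_eq_Suc)
  with js(1) have "js = [a, b] \<or> js = [b, a]" by (auto simp: add_eq_conv_ex)
  then show "moment (count_list [a, b]) \<theta> = E (\<lambda>v. v a * v b + S a b)"
    using js(2) low(2) by (auto simp: E_def S_def sym[unfolded S_def, of b a] mult.commute)
  obtain js where js: "mset js = mset [a, a, b]" "moment (count_list [a, a, b]) \<theta> = pdiffs js (mgf \<theta>) (\<lambda>_. 0)"
    using moment_eq_pdiffs[of "[a, a, b]" \<theta>] by blast
  have "length js = 3" using mset_eq_length[OF js(1)] by simp
  then obtain x y z where "js = [x, y, z]" by (auto simp: length_Suc_conv numeral_eq_Suc)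
  with js(1) have "js = [a, a, b] \<or> js = [a, b, a] \<or> js = [b, a, a]"
    by (auto simp: add_eq_conv_ex)
  then show "moment (count_list [a, a, b]) \<theta> = E (\<lambda>v. v a ^ 2 * v b + S a a * v b + 2 * S a b * v a)"
    using js(2) low(3) by (auto simp: E_def S_def sym[unfolded S_def, of b a] power2_eq_square algebra_simps)
  have *: "js = replicate n a" if "mset js = mset (replicate n a)" for js n
    using that mset_eq_length[OF that] mset_eq_setD[OF that]
    by (intro replicate_eqI) (auto split: if_splits)
  obtain js where js: "mset js = mset (replicate 4 a)"
    "moment (count_list (replicate 4 a)) \<theta> = pdiffs js (mgf \<theta>) (\<lambda>_. 0)"
    using moment_eq_pdiffs by blast
  then show "moment (count_list [a, a, a, a]) \<theta> = E (\<lambda>v. v a ^ 4 + 6 * S a a * v a ^ 2 + 3 * S a a ^ 2)"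
    using *[OF js(1)] low(4) by (simp add: E_def S_def numeral_eq_Suc)
  obtain js where js: "mset js = mset (replicate 5 a)"
    "moment (count_list (replicate 5 a)) \<theta> = pdiffs js (mgf \<theta>) (\<lambda>_. 0)"
    using moment_eq_pdiffs by blast
  then show "moment (count_list [a, a, a, a, a]) \<theta> =
      E (\<lambda>v. v a ^ 5 + 10 * S a a * v a ^ 3 + 15 * S a a ^ 2 * v a)"
    using *[OF js(1)] low(5) by (simp add: E_def S_def numeral_eq_Suc)
qed

lemma moment_map_count_list:
  fixes \<theta> :: "('n::finite, 'k::finite) hparam"
  assumes "1 \<le> length js" "length js \<le> d"
  shows "moment_map d \<theta> (count_list js) = moment (count_list js) \<theta>"
  using assms sum_count_set[of js UNIV] by (simp add: moment_map_def)

section \<open>Coordinates for two-component mixtures\<close>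

datatype 'n coord = Delta 'n | Skew | Cov "'n set" | Mean 'n

text \<open>
  \<open>Delta\<close>, \<open>Mean\<close> and \<open>Cov {j, l}\<close> are the entries of \<open>\<delta>\<close>, \<open>m\<close> and \<open>K\<close>, and
  \<open>Skew = p - 1/2\<close> so that third cumulants vanish at the origin.
\<close>

definition weight :: "('n coord \<Rightarrow> real) \<Rightarrow> real" where
  "weight x = 1/2 + x Skew"

text \<open>This solves the definitions of m, \<delta> and K for the two means and \<Sigma>. The
  constraints of \<open>Theta_H\<close> hold for every x, so the coordinates are free.\<close>

definition param :: "('n coord \<Rightarrow> real) \<Rightarrow> ('n, 2) hparam" where
  "param x = (\<lambda>c. case c of
       Inl (i, j) \<Rightarrow> if i = 1 then x (Mean j) - (1 - weight x) * x (Delta j)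
                             else x (Mean j) + weight x * x (Delta j)
     | Inr (Inl i) \<Rightarrow> if i = 1 then weight x else 1 - weight x
     | Inr (Inr (j, l)) \<Rightarrow> x (Cov {j, l}) - weight x * (1 - weight x) * x (Delta j) * x (Delta l))"

lemma hmu_param: "hmu (param x) i j = (if i = 1 then x (Mean j) - (1 - weight x) * x (Delta j)
    else x (Mean j) + weight x * x (Delta j))"
  and hlam_param: "hlam (param x) i = (if i = 1 then weight x else 1 - weight x)"
  and hSigma_param: "hSigma (param x) j l = x (Cov {j, l}) - weight x * (1 - weight x) * x (Delta j) * x (Delta l)"
  by (simp_all add: hmu_def hlam_def hSigma_def param_def)

lemma hparam_eqI:
  assumes "\<And>i j. hmu \<theta> i j = hmu \<theta>' i j" "\<And>i. hlam \<theta> i = hlam \<theta>' i" "\<And>j l. hSigma \<theta> j l = hSigma \<theta>' j l"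
  shows "\<theta> = \<theta>'"
proof
  fix c
  show "\<theta> c = \<theta>' c"
  proof (cases c)
    case (Inl p)
    then show ?thesis using assms(1) by (cases p) (simp add: hmu_def)
  next
    case (Inr q)
    then show ?thesis using assms(2,3) by (cases q) (auto simp: hlam_def hSigma_def)
  qed
qed

lemma param_in_Theta_H: "param x \<in> (Theta_H :: ('n::finite, 2) hparam set)"
  by (simp add: Theta_H_def sum_2 hlam_param hSigma_param insert_commute mult_ac)

lemma Theta_H_eq_range_param: "(Theta_H :: ('n::finite, 2) hparam set) = range param"
proof
  show "range param \<subseteq> Theta_H" using param_in_Theta_H by auto
  show "(Theta_H :: ('n, 2) hparam set) \<subseteq> range param"
  proof
    fix \<theta> :: "('n, 2) hparam" assume \<theta>: "\<theta> \<in> Theta_H"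
    \<comment> \<open>The two labels are written 1 and 2; in type \<open>2\<close> the latter is the
      element 0.\<close>
    have l: "hlam \<theta> 2 = 1 - hlam \<theta> 1" using \<theta> by (simp add: Theta_H_def sum_2)
    define d where "d j = hmu \<theta> 2 j - hmu \<theta> 1 j" for j
    define K where "K j l = hSigma \<theta> j l + hlam \<theta> 1 * hlam \<theta> 2 * d j * d l" for j l
    have K_sym: "K j l = K l j" for j l using \<theta> by (simp add: K_def Theta_H_def mult_ac)
    \<comment> \<open>The set {j, l} can also be read as {l, j}; by symmetry of K both give the same
      value, which makes the \<open>THE\<close> well defined.\<close>
    define x where "x c = (case c of Delta j \<Rightarrow> d j | Skew \<Rightarrow> hlam \<theta> 1 - 1/2
      | Cov s \<Rightarrow> (THE v. \<exists>j l. s = {j, l} \<and> v = K j l)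
      | Mean j \<Rightarrow> hlam \<theta> 1 * hmu \<theta> 1 j + hlam \<theta> 2 * hmu \<theta> 2 j)" for c
    have Cov: "x (Cov {j, l}) = K j l" for j l
    proof -
      have "(THE v. \<exists>j' l'. {j, l} = {j', l'} \<and> v = K j' l') = K j l"
        by (rule the_equality) (auto simp: doubleton_eq_iff K_sym)
      then show ?thesis by (simp add: x_def)
    qed
    have x: "weight x = hlam \<theta> 1" "\<And>j. x (Delta j) = d j"
      "\<And>j. x (Mean j) = hlam \<theta> 1 * hmu \<theta> 1 j + hlam \<theta> 2 * hmu \<theta> 2 j"
      by (simp_all add: x_def weight_def)
    have "\<theta> = param x"
    proof (rule hparam_eqI)
      show "hmu \<theta> i j = hmu (param x) i j" for i j
        using exhaust_2[of i] by (auto simp: hmu_param x d_def l algebra_simps)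
      show "hlam \<theta> i = hlam (param x) i" for i
        using exhaust_2[of i] by (auto simp: hlam_param x l)
      show "hSigma \<theta> j l = hSigma (param x) j l" for j l
        by (simp add: hSigma_param Cov x K_def l power2_eq_square algebra_simps)
    qed
    then show "\<theta> \<in> range param" by simp
  qed
qed

lemma param_poly: "(\<lambda>x. param x c) \<in> poly_fun"
proof (cases c)
  case (Inl p)
  obtain i j where "p = (i, j)" by force
  with Inl show ?thesis unfolding param_def weight_def
    by (cases "i = 1") (simp_all, (intro poly_fun.add poly_fun.mult poly_fun_diff poly_fun.const poly_fun.var)+)
next
  case (Inr q)
  show ?thesis
  proof (cases q)
    case (Inl i)
    with Inr show ?thesis unfolding param_def weight_def
      by (cases "i = 1") (simp_all, (intro poly_fun.add poly_fun.mult poly_fun_diff poly_fun.const poly_fun.var)+)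
  next
    case r: (Inr r)
    obtain j l where "r = (j, l)" by force
    with Inr r show ?thesis unfolding param_def weight_def
      by simp (intro poly_fun.add poly_fun.mult poly_fun_diff poly_fun_power poly_fun.const poly_fun.var)
  qed
qed

text \<open>At the origin each exponential is 1 and the tilted mean is the mean, so only the
  polynomial factor remains.\<close>

lemma moment_poly:
  "\<exists>W\<in>poly_fun. \<forall>\<theta>\<in>(Theta_H :: ('n::finite, 'k::finite) hparam set). moment a \<theta> = W \<theta>"
proof -
  obtain Q where Q: "Q \<in> poly_fun" "\<And>\<theta>. \<theta> \<in> (Theta_H :: ('n, 'k) hparam set) \<Longrightarrow>
    pdiffs (SOME js. \<forall>j. count_list js j = a j) (mgf \<theta>) = (\<lambda>u. \<Sum>i\<in>UNIV. hlam \<theta> i *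
      Q (case_sum (\<lambda>(j, l). hSigma \<theta> j l) (tilted_mean \<theta> i u)) * component_mgf \<theta> i u)"
    using pdiffs_mgf_poly by blast
  let ?W = "\<lambda>\<theta> :: ('n, 'k) hparam. \<Sum>i\<in>UNIV. hlam \<theta> i * Q (case_sum (\<lambda>(j, l). hSigma \<theta> j l) (hmu \<theta> i))"
  have "(\<lambda>\<theta> :: ('n, 'k) hparam. case_sum (\<lambda>(j, l). hSigma \<theta> j l) (hmu \<theta> i) c) \<in> poly_fun" for i c
    by (cases c) (auto simp: hSigma_def hmu_def case_prod_unfold intro: poly_fun.var)
  then have "(\<lambda>\<theta> :: ('n, 'k) hparam. Q (case_sum (\<lambda>(j, l). hSigma \<theta> j l) (hmu \<theta> i))) \<in> poly_fun" for i
    using poly_fun_compose[OF Q(1), of "\<lambda>\<theta>. case_sum (\<lambda>(j, l). hSigma \<theta> j l) (hmu \<theta> i)"] by blast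
  then have "?W \<in> poly_fun"
    by (intro poly_fun_sum poly_fun.mult) (auto simp: hlam_def intro: poly_fun.var)
  moreover have "moment a \<theta> = ?W \<theta>" if "\<theta> \<in> Theta_H" for \<theta>
    by (simp add: moment_def Q(2)[OF that] tilted_mean_0 component_mgf_0)
  ultimately show ?thesis by (intro bexI[of _ ?W] ballI)
qed

lemma moment_map_param_poly: "(\<lambda>x. moment_map d (param x :: ('n::finite, 2) hparam) a) \<in> poly_fun"
proof -
  obtain W where W: "W \<in> poly_fun" "\<And>\<theta>. \<theta> \<in> (Theta_H :: ('n, 2) hparam set) \<Longrightarrow> moment a \<theta> = W \<theta>"
    using moment_poly by blast
  have "(\<lambda>x. W (param x)) \<in> poly_fun" using poly_fun_compose[OF W(1), of param] param_poly by blast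
  then show ?thesis
    using W(2)[OF param_in_Theta_H]
    by (cases "1 \<le> sum a UNIV \<and> sum a UNIV \<le> d") (auto simp: moment_map_def poly_fun.const simp del: One_nat_def)
qed

section \<open>Moments up to order five expressed through cumulants\<close>

lemma mixture_moment_4:
  fixes p m d K :: real
  defines "s \<equiv> K - p * (1 - p) * d * d"
  shows "p * ((m - (1 - p) * d) ^ 4 + 6 * s * (m - (1 - p) * d) ^ 2 + 3 * s ^ 2)
    + (1 - p) * ((m + p * d) ^ 4 + 6 * s * (m + p * d) ^ 2 + 3 * s ^ 2) =
    p * (1 - p) * (1 - 6 * p * (1 - p)) * d ^ 4 + 3 * K ^ 2
    + 4 * ((2 * p - 1) * p * (1 - p) * d ^ 3) * m + 6 * K * m ^ 2 + m ^ 4"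
  unfolding s_def by algebra

lemma mixture_moment_5:
  fixes p m d K :: real
  defines "s \<equiv> K - p * (1 - p) * d * d"
  shows "p * ((m - (1 - p) * d) ^ 5 + 10 * s * (m - (1 - p) * d) ^ 3 + 15 * s ^ 2 * (m - (1 - p) * d))
    + (1 - p) * ((m + p * d) ^ 5 + 10 * s * (m + p * d) ^ 3 + 15 * s ^ 2 * (m + p * d)) =
    (2 * p - 1) * p * (1 - p) * (1 - 12 * p * (1 - p)) * d ^ 5
    + 10 * K * ((2 * p - 1) * p * (1 - p) * d ^ 3)
    + 5 * (p * (1 - p) * (1 - 6 * p * (1 - p)) * d ^ 4 + 3 * K ^ 2) * m
    + 10 * ((2 * p - 1) * p * (1 - p) * d ^ 3) * m ^ 2 + 10 * K * m ^ 3 + m ^ 5"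
  unfolding s_def by algebra

lemma mixture_moment_3:
  fixes p m d Kaa Kab n e :: real
  defines "s \<equiv> Kaa - p * (1 - p) * d * d" and "s' \<equiv> Kab - p * (1 - p) * d * e"
  shows "p * ((m - (1 - p) * d) ^ 2 * (n - (1 - p) * e) + s * (n - (1 - p) * e) + 2 * s' * (m - (1 - p) * d))
    + (1 - p) * ((m + p * d) ^ 2 * (n + p * e) + s * (n + p * e) + 2 * s' * (m + p * d)) =
    (2 * p - 1) * p * (1 - p) * d ^ 2 * e + Kaa * n + 2 * Kab * m + m ^ 2 * n"
  unfolding s_def s'_def by algebra

text \<open>This and the next two are cumulants of the vector equal to - (1 - p) \<delta> with
  probability p and to p \<delta> with probability 1 - p. The independent Gaussian part has no
  cumulants above order two.\<close>

definition cumulant3 :: "('n coord \<Rightarrow> real) \<Rightarrow> 'n \<Rightarrow> 'n \<Rightarrow> real" where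
  "cumulant3 x a b = (2 * weight x - 1) * weight x * (1 - weight x) * x (Delta a) ^ 2 * x (Delta b)"

definition cumulant4 :: "('n coord \<Rightarrow> real) \<Rightarrow> 'n \<Rightarrow> real" where
  "cumulant4 x a = weight x * (1 - weight x) * (1 - 6 * weight x * (1 - weight x)) * x (Delta a) ^ 4"

definition cumulant5 :: "('n coord \<Rightarrow> real) \<Rightarrow> 'n \<Rightarrow> real" where
  "cumulant5 x a = (2 * weight x - 1) * weight x * (1 - weight x) * (1 - 12 * weight x * (1 - weight x)) * x (Delta a) ^ 5"

text \<open>The usual expansion of moments in cumulants; those of order one and two are m and K, the
  mean and covariance of the mixture.\<close>

lemma moment_param:
  shows "moment (count_list [a]) (param x) = x (Mean a)"
    and "moment (count_list [a, b]) (param x) = x (Cov {a, b}) + x (Mean a) * x (Mean b)"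
    and "moment (count_list [a, a, b]) (param x) = cumulant3 x a b
      + x (Cov {a}) * x (Mean b) + 2 * x (Cov {a, b}) * x (Mean a) + x (Mean a) ^ 2 * x (Mean b)"
    and "moment (count_list [a, a, a, a]) (param x) = cumulant4 x a + 3 * x (Cov {a}) ^ 2
      + 4 * cumulant3 x a a * x (Mean a) + 6 * x (Cov {a}) * x (Mean a) ^ 2 + x (Mean a) ^ 4"
    and "moment (count_list [a, a, a, a, a]) (param x) = cumulant5 x a
      + 10 * x (Cov {a}) * cumulant3 x a a + 5 * (cumulant4 x a + 3 * x (Cov {a}) ^ 2) * x (Mean a)
      + 10 * cumulant3 x a a * x (Mean a) ^ 2 + 10 * x (Cov {a}) * x (Mean a) ^ 3 + x (Mean a) ^ 5"
proof -
  note params = sum_2 hlam_param hmu_param hSigma_param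
  show "moment (count_list [a]) (param x) = x (Mean a)"
    unfolding moment_low_order(1)[OF param_in_Theta_H] by (simp add: params algebra_simps)
  show "moment (count_list [a, b]) (param x) = x (Cov {a, b}) + x (Mean a) * x (Mean b)"
    unfolding moment_low_order(2)[OF param_in_Theta_H] by (simp add: params algebra_simps)
  show "moment (count_list [a, a, b]) (param x) = cumulant3 x a b
      + x (Cov {a}) * x (Mean b) + 2 * x (Cov {a, b}) * x (Mean a) + x (Mean a) ^ 2 * x (Mean b)"
    unfolding moment_low_order(3)[OF param_in_Theta_H]
    using mixture_moment_3[of "weight x" "x (Mean a)" "x (Delta a)" "x (Mean b)" "x (Delta b)" "x (Cov {a})" "x (Cov {a, b})"]
    by (simp add: params cumulant3_def)
  show "moment (count_list [a, a, a, a]) (param x) = cumulant4 x a + 3 * x (Cov {a}) ^ 2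
      + 4 * cumulant3 x a a * x (Mean a) + 6 * x (Cov {a}) * x (Mean a) ^ 2 + x (Mean a) ^ 4"
    unfolding moment_low_order(4)[OF param_in_Theta_H]
    using mixture_moment_4[of "weight x" "x (Mean a)" "x (Delta a)" "x (Cov {a})"]
    by (simp add: params cumulant3_def cumulant4_def power2_eq_square power3_eq_cube mult.assoc)
  show "moment (count_list [a, a, a, a, a]) (param x) = cumulant5 x a
      + 10 * x (Cov {a}) * cumulant3 x a a + 5 * (cumulant4 x a + 3 * x (Cov {a}) ^ 2) * x (Mean a)
      + 10 * cumulant3 x a a * x (Mean a) ^ 2 + 10 * x (Cov {a}) * x (Mean a) ^ 3 + x (Mean a) ^ 5"
    unfolding moment_low_order(5)[OF param_in_Theta_H]
    using mixture_moment_5[of "weight x" "x (Mean a)" "x (Delta a)" "x (Cov {a})"]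
    by (simp add: params cumulant3_def cumulant4_def cumulant5_def power2_eq_square power3_eq_cube mult.assoc)
qed

section \<open>Identifiability\<close>

text \<open>The order in which the coordinates are switched on, with \<open>k\<close> a fixed direction.\<close>

fun coord_rank :: "'n \<Rightarrow> 'n coord \<Rightarrow> nat" where
  "coord_rank k (Delta j) = (if j = k then 0 else 2)"
| "coord_rank k Skew = 1"
| "coord_rank k (Cov s) = 3"
| "coord_rank k (Mean j) = 4"

text \<open>\<open>Cov\<close> accepts any set, but \<open>param\<close> reads only sets of one or
  two elements; only these are counted.\<close>

definition param_coords :: "'n coord set" where
  "param_coords = range Delta \<union> {Skew} \<union> range (\<lambda>(j, l). Cov {j, l}) \<union> range Mean"

lemma finite_param_coords: "finite (param_coords :: 'n::finite coord set)"
  by (simp add: param_coords_def)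

lemma param_restrict: "param (\<lambda>c. if c \<in> param_coords then x c else 0) = param x"
proof -
  have "Delta j \<in> param_coords" "Skew \<in> param_coords" "Cov {j, l} \<in> param_coords" "Mean j \<in> param_coords"
    for j l :: 'a
    by (auto simp: param_coords_def intro: image_eqI[of _ _ "(j, l)"])
  then show ?thesis
    by (intro hparam_eqI) (auto simp: hmu_param hlam_param hSigma_param weight_def)
qed

text \<open>The witness has the order of the cumulant that the coordinate activates; means and
  covariances that would disturb it are still off. The start needs order four, because at weight 1/2
  all third cumulants vanish.\<close>

lemma moment_separates_coord:
  fixes A :: "'n::finite coord set"
  assumes c: "c \<in> param_coords" "c \<notin> A"
    and below: "\<And>c'. c' \<in> A \<Longrightarrow> coord_rank k c' \<le> coord_rank k c"
    and above: "\<And>c'. c' \<in> param_coords \<Longrightarrow> coord_rank k c' < coord_rank k c \<Longrightarrow> c' \<in> A"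
  shows "\<exists>js. 1 \<le> length js \<and> length js \<le> 4 \<and>
    (\<forall>x. (\<forall>c. c \<notin> A \<longrightarrow> x c = 0) \<longrightarrow> moment (count_list js) (param x) = 0) \<and>
    (\<exists>x. (\<forall>c'. c' \<notin> insert c A \<longrightarrow> x c' = 0) \<and> moment (count_list js) (param x) \<noteq> 0)"
proof -
  \<comment> \<open>\<open>Skew\<close> 1/4 gives weight 3/4, away from 1/2, where third cumulants
    vanish, and from 0 and 1, where one component disappears.\<close>
  define e where "e B c = (if c \<in> B then if c = Skew then 1/4 else 1 else 0 :: real)" for B and c :: "'n coord"
  have Mean: "Mean j \<notin> A" if "coord_rank k c < 4" for j using below[of "Mean j"] that by auto
  have Cov: "Cov s \<notin> A" if "coord_rank k c < 3" for s using below[of "Cov s"] that by auto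
  show ?thesis
  proof (cases c)
    case (Mean j)
    have "moment (count_list [j]) (param (e {c})) \<noteq> 0" by (simp add: moment_param(1) e_def Mean)
    then show ?thesis using c(2) Mean
      by (intro exI[of _ "[j]"] conjI exI[of _ "e {c}"]) (simp_all add: moment_param(1), simp add: e_def)
  next
    case (Cov s)
    then obtain j l where s: "s = {j, l}" using c(1) by (auto simp: param_coords_def)
    have "moment (count_list [j, l]) (param (e {c})) \<noteq> 0" by (simp add: moment_param(2) e_def Cov s)
    then show ?thesis using c(2) Cov s Mean
      by (intro exI[of _ "[j, l]"] conjI exI[of _ "e {c}"]) (simp_all add: moment_param(2), simp add: e_def)
  next
    case Skew
    have "Delta k \<in> A" using above[of "Delta k"] Skew by (simp add: param_coords_def)
    have "moment (count_list [k, k, k]) (param (e {Delta k, Skew})) \<noteq> 0"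
      by (simp add: moment_param(3) e_def cumulant3_def weight_def)
    \<comment> \<open>With \<open>Skew\<close> off the weight is 1/2, so the factor
      \<open>2 * weight x - 1\<close> is zero.\<close>
    moreover have "moment (count_list [k, k, k]) (param x) = 0" if "\<forall>c. c \<notin> A \<longrightarrow> x c = 0" for x
      using that c(2) Mean Skew by (simp add: moment_param(3) cumulant3_def weight_def)
    ultimately show ?thesis using \<open>Delta k \<in> A\<close> Skew
      by (intro exI[of _ "[k, k, k]"] conjI exI[of _ "e {Delta k, Skew}"]) (simp_all, auto simp: e_def)
  next
    case (Delta j)
    show ?thesis
    proof (cases "j = k")
      case True
      \<comment> \<open>At weight 1/2 and difference 1 the fourth cumulant is 1/4 (1 - 6/4) =
        -1/8.\<close>
      have "moment (count_list [k, k, k, k]) (param (e {Delta k})) \<noteq> 0"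
        by (simp add: moment_param(4) e_def cumulant4_def weight_def)
      moreover have "moment (count_list [k, k, k, k]) (param x) = 0" if "\<forall>c. c \<notin> A \<longrightarrow> x c = 0" for x
        using that c(2) Mean Cov Delta True by (simp add: moment_param(4) cumulant3_def cumulant4_def)
      ultimately show ?thesis using Delta True
        by (intro exI[of _ "[k, k, k, k]"] conjI exI[of _ "e {Delta k}"]) (simp_all, auto simp: e_def)
    next
      case False
      have "Delta k \<in> A" "Skew \<in> A"
        using above[of "Delta k"] above[of Skew] Delta False by (simp_all add: param_coords_def)
      have "moment (count_list [k, k, j]) (param (e {Delta k, Skew, Delta j})) \<noteq> 0"
        by (simp add: moment_param(3) e_def cumulant3_def weight_def)
      moreover have "moment (count_list [k, k, j]) (param x) = 0" if "\<forall>c. c \<notin> A \<longrightarrow> x c = 0" for x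
        using that c(2) Mean Cov Delta False by (simp add: moment_param(3) cumulant3_def)
      ultimately show ?thesis using \<open>Delta k \<in> A\<close> \<open>Skew \<in> A\<close> Delta
        by (intro exI[of _ "[k, k, j]"] conjI exI[of _ "e {Delta k, Skew, Delta j}"]) (simp_all, auto simp: e_def)
    qed
  qed
qed

lemma set_take_Suc: "i < length xs \<Longrightarrow> set (take (Suc i) xs) = insert (xs ! i) (set (take i xs))"
  by (simp add: take_Suc_conv_app_nth)

text \<open>Sorting by rank makes every prefix satisfy the two rank conditions of
  \<open>moment_separates_coord\<close>; ties may come in any order.\<close>

lemma moment_flag:
  obtains xs :: "'n::finite coord list" where "distinct xs" "set xs = param_coords"
    "\<And>i. i < length xs \<Longrightarrow> \<exists>js. 1 \<le> length js \<and> length js \<le> 4 \<and>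
      (\<forall>x. (\<forall>c. c \<notin> set (take i xs) \<longrightarrow> x c = 0) \<longrightarrow> moment (count_list js) (param x) = 0) \<and>
      (\<exists>x. (\<forall>c. c \<notin> set (take (Suc i) xs) \<longrightarrow> x c = 0) \<and> moment (count_list js) (param x) \<noteq> 0)"
proof -
  fix k :: 'n
  obtain ys :: "'n coord list" where ys: "set ys = param_coords" "distinct ys"
    using finite_distinct_list[OF finite_param_coords] by blast
  define xs where "xs = sort_key (coord_rank k) ys"
  have xs: "distinct xs" "set xs = param_coords" "sorted (map (coord_rank k) xs)"
    using ys by (simp_all add: xs_def)
  show thesis
  proof (rule that[OF xs(1,2)])
    fix i assume i: "i < length xs"
    have mem: "xs ! i \<in> param_coords" using nth_mem[OF i] xs(2) by (simp only:)
    have new: "xs ! i \<notin> set (take i xs)"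
      using distinct_take[OF xs(1), of "Suc i"] by (simp add: take_Suc_conv_app_nth[OF i])
    have below: "coord_rank k c \<le> coord_rank k (xs ! i)" if c: "c \<in> set (take i xs)" for c
    proof -
      obtain j where "j < length (take i xs)" "take i xs ! j = c"
        using c by (metis in_set_conv_nth)
      then have "j < i" "c = xs ! j" by auto
      then show ?thesis using sorted_nth_mono[OF xs(3), of j i] i by simp
    qed
    have above: "c \<in> set (take i xs)"
      if c: "c \<in> param_coords" "coord_rank k c < coord_rank k (xs ! i)" for c
    proof -
      obtain j where j: "j < length xs" "xs ! j = c" using c(1) xs(2) by (metis in_set_conv_nth)
      have "j < i"
      proof (rule ccontr)
        assume "\<not> j < i"
        then show False using sorted_nth_mono[OF xs(3), of i j] j c(2) by simp
      qed
      then have "take i xs ! j = c" "j < length (take i xs)" using j by simp_all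
      then show ?thesis by (metis nth_mem)
    qed
    show "\<exists>js. 1 \<le> length js \<and> length js \<le> 4 \<and>
      (\<forall>x. (\<forall>c. c \<notin> set (take i xs) \<longrightarrow> x c = 0) \<longrightarrow> moment (count_list js) (param x) = 0) \<and>
      (\<exists>x. (\<forall>c. c \<notin> set (take (Suc i) xs) \<longrightarrow> x c = 0) \<and> moment (count_list js) (param x) \<noteq> 0)"
      unfolding set_take_Suc[OF i] by (rule moment_separates_coord[OF mem new below above])
  qed
qed

section \<open>Equality of the dimensions of the parameter space and the secant\<close>

lemma zariski_closed_Theta_H: "zariski_closed (Theta_H :: ('n::finite, 'k::finite) hparam set)"
proof -
  let ?P = "insert (\<lambda>\<theta>. (\<Sum>i\<in>UNIV. hlam \<theta> i) - 1)
    (\<Union>j l. {\<lambda>\<theta> :: ('n, 'k) hparam. hSigma \<theta> j l - hSigma \<theta> l j})"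
  have "(Theta_H :: ('n, 'k) hparam set) = {\<theta>. \<forall>p\<in>?P. p \<theta> = 0}" by (auto simp: Theta_H_def)
  moreover have "?P \<subseteq> poly_fun"
    by (auto simp: hlam_def hSigma_def intro!: poly_fun_diff poly_fun_sum poly_fun.var poly_fun.const)
  ultimately show ?thesis unfolding zariski_closed_def by blast
qed

lemma Sec_H_eq:
  "Sec_H TYPE('n::finite) TYPE(2) d = zariski_closure (range (\<lambda>x. moment_map d (param x :: ('n, 2) hparam)))"
  by (simp add: Sec_H_def Theta_H_eq_range_param image_image)

text \<open>One list of coordinates with one set of witness moments computes both
  dimensions.\<close>

lemma Delta_H_eq_0: "Delta_H TYPE('n::finite) TYPE(2) 4 = 0"
proof -
  obtain xs :: "'n coord list" where xs: "distinct xs" "set xs = param_coords"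
    and sep: "\<And>i. i < length xs \<Longrightarrow> \<exists>js. 1 \<le> length js \<and> length js \<le> 4 \<and>
      (\<forall>x. (\<forall>c. c \<notin> set (take i xs) \<longrightarrow> x c = 0) \<longrightarrow> moment (count_list js) (param x) = 0) \<and>
      (\<exists>x. (\<forall>c. c \<notin> set (take (Suc i) xs) \<longrightarrow> x c = 0) \<and> moment (count_list js) (param x) \<noteq> 0)"
    using moment_flag by blast
  let ?F = "\<lambda>x. moment_map 4 (param x :: ('n, 2) hparam)"
  have "zariski_dim (Theta_H :: ('n, 2) hparam set) = length xs"
  proof (rule zariski_dim_eqI[where F = param])
    fix i assume "i < length xs"
    then obtain js where js: "\<forall>x. (\<forall>c. c \<notin> set (take i xs) \<longrightarrow> x c = 0) \<longrightarrow> moment (count_list js) (param x) = 0"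
      "\<exists>x. (\<forall>c. c \<notin> set (take (Suc i) xs) \<longrightarrow> x c = 0) \<and> moment (count_list js) (param x) \<noteq> 0"
      using sep by blast
    \<comment> \<open>\<open>moment\<close> is known to be polynomial only on
      \<open>Theta_H\<close>, so the separating function is a polynomial that agrees with it
      there.\<close>
    obtain W where W: "W \<in> poly_fun" "\<forall>\<theta>\<in>(Theta_H :: ('n, 2) hparam set). moment (count_list js) \<theta> = W \<theta>"
      using moment_poly by (rule bexE)
    have "W (param x) = moment (count_list js) (param x)" for x using W(2) param_in_Theta_H by metis
    then show "\<exists>w\<in>poly_fun. (\<forall>x. (\<forall>c. c \<notin> set (take i xs) \<longrightarrow> x c = 0) \<longrightarrow> w (param x :: ('n, 2) hparam) = 0) \<and>
      (\<exists>x. (\<forall>c. c \<notin> set (take (Suc i) xs) \<longrightarrow> x c = 0) \<and> w (param x) \<noteq> 0)"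
      using js W(1) by (intro bexI[of _ W]) simp_all
  next
    show "Theta_H \<subseteq> zariski_closure (range (param :: _ \<Rightarrow> ('n, 2) hparam))"
      unfolding Theta_H_eq_range_param by (rule zariski_closure_subset)
  qed (use xs zariski_closed_Theta_H in \<open>simp_all add: param_poly param_restrict flip: Theta_H_eq_range_param\<close>)
  moreover have "zariski_dim (Sec_H TYPE('n) TYPE(2) 4) = length xs"
  proof (rule zariski_dim_eqI[where F = ?F])
    fix i assume "i < length xs"
    then obtain js where js: "1 \<le> length js" "length js \<le> 4"
      "\<forall>x. (\<forall>c. c \<notin> set (take i xs) \<longrightarrow> x c = 0) \<longrightarrow> moment (count_list js) (param x) = 0"
      "\<exists>x. (\<forall>c. c \<notin> set (take (Suc i) xs) \<longrightarrow> x c = 0) \<and> moment (count_list js) (param x) \<noteq> 0"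
      using sep by blast
    \<comment> \<open>Here the moment is a coordinate of the ambient space; order at most 4 keeps
      \<open>moment_map 4\<close> from replacing it by 0.\<close>
    then show "\<exists>w\<in>poly_fun. (\<forall>x. (\<forall>c. c \<notin> set (take i xs) \<longrightarrow> x c = 0) \<longrightarrow> w (?F x) = 0) \<and>
      (\<exists>x. (\<forall>c. c \<notin> set (take (Suc i) xs) \<longrightarrow> x c = 0) \<and> w (?F x) \<noteq> 0)"
      by (intro bexI[of _ "\<lambda>y. y (count_list js)"]) (simp_all add: moment_map_count_list poly_fun.var)
  next
    show "zariski_closed (Sec_H TYPE('n) TYPE(2) 4)" unfolding Sec_H_eq by (rule zariski_closed_closure)
    show "range ?F \<subseteq> Sec_H TYPE('n) TYPE(2) 4" unfolding Sec_H_eq by (rule zariski_closure_subset)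
    show "Sec_H TYPE('n) TYPE(2) 4 \<subseteq> zariski_closure (range ?F)" unfolding Sec_H_eq by (rule order_refl)
  qed (use xs in \<open>simp_all add: moment_map_param_poly param_restrict\<close>)
  ultimately show ?thesis by (simp add: Delta_H_def)
qed

section \<open>Label swapping and the general fiber from order five on\<close>

definition flip :: "('n coord \<Rightarrow> real) \<Rightarrow> 'n coord \<Rightarrow> real" where
  "flip x c = (case c of Delta j \<Rightarrow> - x (Delta j) | Skew \<Rightarrow> - x Skew | _ \<Rightarrow> x c)"

lemma flip_simps [simp]: "flip x (Delta j) = - x (Delta j)" "weight (flip x) = 1 - weight x"
  "flip x (Cov s) = x (Cov s)" "flip x (Mean j) = x (Mean j)"
  by (simp_all add: flip_def weight_def)

lemma swap_labels_simps:
  "hmu (swap_labels \<theta>) i = hmu \<theta> (i + 1)" "hlam (swap_labels \<theta>) i = hlam \<theta> (i + 1)"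
  "hSigma (swap_labels \<theta>) = hSigma \<theta>"
  by (simp_all add: hmu_def hlam_def hSigma_def swap_labels_def fun_eq_iff)

lemma swap_labels_param: "swap_labels (param x) = param (flip x)"
proof (rule hparam_eqI)
  have [simp]: "(3::2) = 1" by simp
  show "hmu (swap_labels (param x)) i j = hmu (param (flip x)) i j" for i j
    using exhaust_2[of i] by (auto simp: swap_labels_simps hmu_param algebra_simps)
  show "hlam (swap_labels (param x)) i = hlam (param (flip x)) i" for i
    using exhaust_2[of i] by (auto simp: swap_labels_simps hlam_param)
  show "hSigma (swap_labels (param x)) j l = hSigma (param (flip x)) j l" for j l
    by (simp add: swap_labels_simps hSigma_param)
qed

lemma moment_map_swap_labels:
  fixes \<theta> :: "('n::finite, 2) hparam"
  shows "moment_map d (swap_labels \<theta>) = moment_map d \<theta>"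
proof -
  have [simp]: "(3::2) = 1" by simp
  have "mgf (swap_labels \<theta>) = mgf \<theta>" by (simp add: mgf_def sum_2 fun_eq_iff swap_labels_simps)
  then show ?thesis unfolding moment_map_def moment_def by (simp only:)
qed

text \<open>With k = P S, the second and third equations say that k S - 2 P^2 and k (S^2 - 8 P)
  agree on both sides; dividing the latter by k leaves two relations between S - S' and P -
  P'.\<close>

lemma cumulants_determine:
  fixes P S P' S' :: real
  assumes k3: "P * S = P' * S'" and k4: "P * S ^ 2 - 2 * P ^ 2 = P' * S' ^ 2 - 2 * P' ^ 2"
    and k5: "P * S ^ 3 - 8 * P ^ 2 * S = P' * S' ^ 3 - 8 * P' ^ 2 * S'" and nz: "P * S \<noteq> 0"
  shows "P = P'" "S = S'"
proof -
  define k where "k = P * S"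
  have k: "k \<noteq> 0" "P * S = k" "P' * S' = k" using nz k3 by (simp_all add: k_def)
  have a: "k * (S - S') = 2 * (P - P') * (P + P')" using k4 k by algebra
  have "k * (S ^ 2 - 8 * P) = k * (S' ^ 2 - 8 * P')" using k5 k by algebra
  then have "S ^ 2 - 8 * P = S' ^ 2 - 8 * P'" using k(1) by simp
  then have b: "(S - S') * (S + S') = 8 * (P - P')" by algebra
  \<comment> \<open>Multiplying \<open>a\<close> by S + S' and inserting \<open>b\<close> eliminates
    S - S'.\<close>
  have "(P - P') * (4 * k - (P + P') * (S + S')) = 0" using a b by algebra
  then have "P = P'"
  proof (rule mult_eq_0_iff[THEN iffD1, THEN disjE])
    \<comment> \<open>P S' and P' S have sum 2 k and product k^2, so both equal k.\<close>
    assume "4 * k - (P + P') * (S + S') = 0"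
    then have sum: "P * S' + P' * S = 2 * k" using k by algebra
    have "(P * S' - k) ^ 2 = 0" using sum k by algebra
    then have "P * S' = P * S" using k by simp
    then have "S' = S" using nz by simp
    then show ?thesis using k3 nz by auto
  qed simp
  then show "P = P'" "S = S'" using k3 nz by auto
qed

text \<open>S and \<delta> in direction k give the weight. Then \<open>cumulant3 x k j\<close> is
  linear in \<open>x (Delta j)\<close> with a nonzero coefficient, which recovers the rest of
  \<delta>.\<close>

lemma param_eq_if_cumulants_eq:
  fixes x x' :: "'n::finite coord \<Rightarrow> real"
  assumes "\<And>j. x (Mean j) = x' (Mean j)" "\<And>j l. x (Cov {j, l}) = x' (Cov {j, l})"
    and k3: "\<And>j. cumulant3 x k j = cumulant3 x' k j" "cumulant3 x k k \<noteq> 0"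
    and S: "(2 * weight x - 1) * x (Delta k) = (2 * weight x' - 1) * x' (Delta k)"
    and d: "x (Delta k) = x' (Delta k)"
  shows "param x = param x'"
proof -
  have nz: "x (Delta k) \<noteq> 0" "2 * weight x - 1 \<noteq> 0" "weight x \<noteq> 0" "weight x \<noteq> 1"
    using k3(2) by (auto simp: cumulant3_def)
  have w: "weight x = weight x'" using S d nz(1) by simp
  have "x (Delta j) = x' (Delta j)" for j
    using k3(1)[of j] nz by (simp add: cumulant3_def flip: w d)
  then show ?thesis using assms(1,2) w by (intro hparam_eqI) (simp_all add: hmu_param hlam_param hSigma_param)
qed

lemma param_eq_or_flip:
  fixes x x' :: "'n::finite coord \<Rightarrow> real"
  assumes d: "d \<ge> 5" and eq: "moment_map d (param x') = moment_map d (param x)"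
    and nz: "cumulant3 x k k \<noteq> 0"
  shows "param x' = param x \<or> param x' = param (flip x)"
proof -
  have eq: "moment (count_list js) (param x') = moment (count_list js) (param x)"
    if "1 \<le> length js" "length js \<le> 5" for js
    using fun_cong[OF eq, of "count_list js"] that d by (simp add: moment_map_count_list)
  \<comment> \<open>Going up in order, each moment is one new cumulant plus terms that already
    agree.\<close>
  have M: "x' (Mean j) = x (Mean j)" for j using eq[of "[j]"] by (simp add: moment_param)
  have C: "x' (Cov {j, l}) = x (Cov {j, l})" for j l using eq[of "[j, l]"] by (simp add: moment_param M)
  have C1: "x' (Cov {j}) = x (Cov {j})" for j using C[of j j] by simp
  have k3: "cumulant3 x' k j = cumulant3 x k j" for j
    using eq[of "[k, k, j]"] by (simp add: moment_param M C C1)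
  have k4: "cumulant4 x' k = cumulant4 x k"
    using eq[of "[k, k, k, k]"] by (simp add: moment_param M C1 k3)
  have k5: "cumulant5 x' k = cumulant5 x k"
    using eq[of "[k, k, k, k, k]"] by (simp add: moment_param M C1 k3 k4)
  define P where "P x = weight x * (1 - weight x) * x (Delta k) ^ 2" for x
  define S where "S x = (2 * weight x - 1) * x (Delta k)" for x
  \<comment> \<open>The identity (2 p - 1)^2 = 1 - 4 p (1 - p) turns the cumulants into polynomials
    in P and S and gives \<delta>^2 = S^2 + 4 P in direction k.\<close>
  have c3: "cumulant3 x k k = P x * S x"
    and c4: "cumulant4 x k = P x * S x ^ 2 - 2 * P x ^ 2"
    and c5: "cumulant5 x k = P x * S x ^ 3 - 8 * P x ^ 2 * S x"
    and d2: "x (Delta k) ^ 2 = S x ^ 2 + 4 * P x" for x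
    unfolding cumulant3_def cumulant4_def cumulant5_def P_def S_def by algebra+
  have PS: "P x = P x'" "S x = S x'"
    using cumulants_determine[of "P x" "S x" "P x'" "S x'", folded c3 c4 c5] k3[of k] k4 k5 nz by simp_all
  then have "x (Delta k) ^ 2 = x' (Delta k) ^ 2" by (simp add: d2)
  then consider "x' (Delta k) = x (Delta k)" | "x' (Delta k) = - x (Delta k)"
    by (metis power2_eq_iff)
  then show ?thesis
  proof cases
    case 1
    then have "param x = param x'"
      using PS(2) nz by (intro param_eq_if_cumulants_eq[of x x' k]) (simp_all add: M C k3 S_def)
    then show ?thesis by simp
  next
    case 2
    \<comment> \<open>Two signs cancel, those of 2 p - 1 and of \<open>x (Delta j)\<close>.\<close>
    have k3': "cumulant3 (flip x) k j = cumulant3 x k j" for j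
      unfolding cumulant3_def flip_simps by algebra
    have "param (flip x) = param x'"
      using PS(2) nz 2 by (intro param_eq_if_cumulants_eq[of "flip x" x' k]) (simp_all add: M C k3 k3' S_def algebra_simps)
    then show ?thesis by simp
  qed
qed

text \<open>The exceptional set is where the third cumulant in one fixed direction vanishes, a
  closed condition since cumulants are polynomials in the moments.\<close>

lemma rational_identifiability:
  assumes d: "d \<ge> 5"
  shows "\<exists>Y. zariski_closed Y \<and> Y \<subseteq> Sec_H TYPE('n::finite) TYPE(2) d \<and> Y \<noteq> Sec_H TYPE('n) TYPE(2) d \<and>
       (\<forall>y \<in> moment_map d ` (Theta_H :: ('n, 2) hparam set) - Y.
          \<exists>\<theta>\<in>(Theta_H :: ('n, 2) hparam set).
             {\<theta>'\<in>Theta_H. moment_map d \<theta>' = y} = {\<theta>, swap_labels \<theta>})"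
proof -
  fix k :: 'n
  \<comment> \<open>The third cumulant in terms of raw moments, m3 - 3 m2 m1 + 2 m1^3.\<close>
  define w where "w y = y (count_list [k, k, k]) - 3 * y (count_list [k, k]) * y (count_list [k])
    + 2 * y (count_list [k]) ^ 3" for y :: "('n \<Rightarrow> nat) \<Rightarrow> real"
  have w_poly: "w \<in> poly_fun"
    unfolding w_def[abs_def]
    by (intro poly_fun.add poly_fun_diff poly_fun.mult poly_fun_power poly_fun.const poly_fun.var)
  have w: "w (moment_map d (param x)) = cumulant3 x k k" for x
    using d by (simp add: w_def moment_map_count_list moment_param del: count_list.simps)
      (simp add: algebra_simps power2_eq_square power3_eq_cube)
  define Y where "Y = Sec_H TYPE('n) TYPE(2) d \<inter> {y. w y = 0}"
  have Sec: "zariski_closed (Sec_H TYPE('n) TYPE(2) d)" unfolding Sec_H_eq by (rule zariski_closed_closure)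
  have image_Sec: "moment_map d (param x :: ('n, 2) hparam) \<in> Sec_H TYPE('n) TYPE(2) d" for x
    unfolding Sec_H_eq
    using rangeI[of "\<lambda>x. moment_map d (param x :: ('n, 2) hparam)" x] zariski_closure_subset
    by (rule rev_subsetD)
  show ?thesis
  proof (intro exI[of _ Y] conjI ballI)
    show "zariski_closed Y" unfolding Y_def by (intro zariski_closed_Int Sec zariski_closed_zeros w_poly)
    show "Y \<subseteq> Sec_H TYPE('n) TYPE(2) d" by (simp add: Y_def)
    \<comment> \<open>Weight 3/4 and all differences 1 give third cumulant 3/32, so Y is a proper
      subset.\<close>
    define x where "x c = (if c = Skew then 1/4 else 1 :: real)" for c :: "'n coord"
    have "w (moment_map d (param x)) \<noteq> 0" by (simp add: w cumulant3_def weight_def x_def)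
    then show "Y \<noteq> Sec_H TYPE('n) TYPE(2) d" using image_Sec[of x] by (auto simp: Y_def)
  next
    fix y assume "y \<in> moment_map d ` (Theta_H :: ('n, 2) hparam set) - Y"
    then obtain x where y: "y = moment_map d (param x :: ('n, 2) hparam)" and "y \<notin> Y"
      by (auto simp: Theta_H_eq_range_param)
    then have nz: "cumulant3 x k k \<noteq> 0" using image_Sec[of x] by (simp add: Y_def w)
    have "{\<theta>' \<in> Theta_H. moment_map d \<theta>' = y} = {param x, swap_labels (param x)}"
    proof
      show "{\<theta>' \<in> Theta_H. moment_map d \<theta>' = y} \<subseteq> {param x, swap_labels (param x)}"
        using param_eq_or_flip[OF d _ nz] by (auto simp: y Theta_H_eq_range_param swap_labels_param)
      show "{param x, swap_labels (param x)} \<subseteq> {\<theta>' \<in> Theta_H. moment_map d \<theta>' = y}"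
        using param_in_Theta_H by (simp add: y moment_map_swap_labels) (simp add: swap_labels_param param_in_Theta_H)
    qed
    then show "\<exists>\<theta>\<in>(Theta_H :: ('n, 2) hparam set).
        {\<theta>' \<in> Theta_H. moment_map d \<theta>' = y} = {\<theta>, swap_labels \<theta>}"
      using param_in_Theta_H by blast
  qed
qed

theorem theorem4p10:
  shows "Delta_H TYPE('n::finite) TYPE(2) 4 = 0 \<and>
    (\<forall>d\<ge>5. \<exists>Y. zariski_closed Y \<and> Y \<subseteq> Sec_H TYPE('n) TYPE(2) d \<and> Y \<noteq> Sec_H TYPE('n) TYPE(2) d \<and>
       (\<forall>y \<in> moment_map d ` (Theta_H :: ('n, 2) hparam set) - Y.
          \<exists>\<theta>\<in>(Theta_H :: ('n, 2) hparam set).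
             {\<theta>'\<in>Theta_H. moment_map d \<theta>' = y} = {\<theta>, swap_labels \<theta>}))"
  using Delta_H_eq_0 rational_identifiability by blast

end
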